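(* Let $G$ be a finite group such that exactly two elements of $cs(G)$ are composite numbers. Then at most three elements of $cs(G)$ are prime numbers. Moreover, if $cs(G)=\{1,p_1,p_2,p_3,m,n\}$, where $p_1,p_2,p_3$ are three distinct primes and $m$ and $n$ are the (exactly two, distinct) composite numbers in $cs(G)$, then, up to interchanging (i.e. relabelling) the primes $p_1,p_2,p_3$ (and $m$, $n$), it holds that $m=p_1p_2$ and $n=p_1p_3$; further, with this labelling, up to abelian direct factors, $G=P\times H$, where $P$ is a $p_1$-group of nilpotency class at most $2$ with $cs(P)=\{1,p_1\}$, and $H$ is a group such that $H/\mathbf{Z}(H)$ is a Frobenius group of order $p_2p_3$ and $cs(H)=\{1,p_2,p_3\}$.
   Context: All groups are finite. For a group $G$ and $x\in G$, $x^G$ denotes the conjugacy class of $x$ in $G$, and $cs(G)=\{|x^G| : x\in G\}$ is the set of all conjugacy class sizes of $G$ (a set, without multiplicities). A composite number is a positive integer that has at least one positive divisor different from $1$ and itself. $\mathbf{Z}(H)$ denotes the centre of $H$. A statement holds for $G$ "up to abelian direct factors" if $G=G_0\times A$ for some abelian subgroup $A$ (possibly trivial) and some subgroup $G_0$ such that the statement holds for $G_0$; note $cs(G_0)=cs(G)$. *)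

theory Defs
  imports "HOL-Algebra.Algebra" "HOL-Computational_Algebra.Primes"
begin

definition composite :: "nat \<Rightarrow> bool" where
  "composite n \<longleftrightarrow> n > 0 \<and> (\<exists>d. d dvd n \<and> d \<noteq> 1 \<and> d \<noteq> n)"

definition conjugacy_class :: "('a, 'b) monoid_scheme \<Rightarrow> 'a \<Rightarrow> 'a set" where
  "conjugacy_class G x =
     orbit G (\<lambda>g. \<lambda>h \<in> carrier G. g \<otimes>\<^bsub>G\<^esub> h \<otimes>\<^bsub>G\<^esub> inv\<^bsub>G\<^esub> g) x"

definition cs :: "('a, 'b) monoid_scheme \<Rightarrow> nat set" where
  "cs G = {card (conjugacy_class G x) | x. x \<in> carrier G}"

definition center :: "('a, 'b) monoid_scheme \<Rightarrow> 'a set" where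
  "center G = {z \<in> carrier G. \<forall>x \<in> carrier G. z \<otimes>\<^bsub>G\<^esub> x = x \<otimes>\<^bsub>G\<^esub> z}"

text \<open>Internal direct products; the factors are subsets of the carrier of the ambient group.
  The subgroup \<open>H\<close> of \<open>G\<close>, viewed as a group, is \<open>G\<lparr>carrier := H\<rparr>\<close>.\<close>

definition internal_direct_product ::
    "('a, 'b) monoid_scheme \<Rightarrow> 'a set \<Rightarrow> 'a set \<Rightarrow> bool" where
  "internal_direct_product G H K \<longleftrightarrow>
     H \<lhd> G \<and> K \<lhd> G \<and> H \<inter> K = {\<one>\<^bsub>G\<^esub>} \<and> H <#>\<^bsub>G\<^esub> K = carrier G"

definition up_to_abelian_direct_factors ::
    "(('a, 'b) monoid_scheme \<Rightarrow> bool) \<Rightarrow> ('a, 'b) monoid_scheme \<Rightarrow> bool" where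
  "up_to_abelian_direct_factors \<Phi> G \<longleftrightarrow>
     (\<exists>G0 A. internal_direct_product G G0 A \<and> comm_group (G\<lparr>carrier := A\<rparr>) \<and>
        \<Phi> (G\<lparr>carrier := G0\<rparr>))"

text \<open>For finite groups. An infinite group has \<open>order\<close> equal to 0 in the library,
  so it is never a \<open>p\<close>-group in this sense when \<open>p\<close> is prime.\<close>

definition p_group :: "nat \<Rightarrow> ('a, 'b) monoid_scheme \<Rightarrow> bool" where
  "p_group p G \<longleftrightarrow> group G \<and> (\<exists>k. order G = p ^ k)"

definition commutator_subgroup ::
    "('a, 'b) monoid_scheme \<Rightarrow> 'a set \<Rightarrow> 'a set \<Rightarrow> 'a set" where
  "commutator_subgroup G H K =
     generate G {h \<otimes>\<^bsub>G\<^esub> k \<otimes>\<^bsub>G\<^esub> inv\<^bsub>G\<^esub> h \<otimes>\<^bsub>G\<^esub> inv\<^bsub>G\<^esub> k | h k. h \<in> H \<and> k \<in> K}"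

text \<open>The series is indexed from 0, so \<open>lower_central G i\<close> is the term usually written
  \<open>\<gamma>\<close> with index \<open>i + 1\<close>; thus the class is the least \<open>c\<close> at which it becomes trivial.\<close>

primrec lower_central :: "('a, 'b) monoid_scheme \<Rightarrow> nat \<Rightarrow> 'a set" where
  "lower_central G 0 = carrier G"
| "lower_central G (Suc i) = commutator_subgroup G (lower_central G i) (carrier G)"

definition nilpotent_group :: "('a, 'b) monoid_scheme \<Rightarrow> bool" where
  "nilpotent_group G \<longleftrightarrow> group G \<and> (\<exists>c. lower_central G c = {\<one>\<^bsub>G\<^esub>})"

text \<open>Only meaningful for nilpotent groups.\<close>

definition nilpotency_class :: "('a, 'b) monoid_scheme \<Rightarrow> nat" where
  "nilpotency_class G = (LEAST c. lower_central G c = {\<one>\<^bsub>G\<^esub>})"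

text \<open>\<open>C\<close> is a Frobenius complement: a nontrivial proper subgroup meeting each of its
  conjugates by elements outside \<open>C\<close> trivially.\<close>

definition frobenius_group :: "('a, 'b) monoid_scheme \<Rightarrow> bool" where
  "frobenius_group G \<longleftrightarrow> group G \<and>
     (\<exists>C. subgroup C G \<and> C \<noteq> {\<one>\<^bsub>G\<^esub>} \<and> C \<noteq> carrier G \<and>
        (\<forall>g \<in> carrier G - C. C \<inter> (g <#\<^bsub>G\<^esub> C #>\<^bsub>G\<^esub> inv\<^bsub>G\<^esub> g) = {\<one>\<^bsub>G\<^esub>}))"

end

(*
If x and y have distinct prime class sizes p < q, then G = C(x) C(y), so the product of the two
classes is a single class, of size pq or q. In the latter case the class of y is a coset of a
normal subgroup N of order q, which contains all commutators of x, and C(N) = C(x) has index p.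
As any nontrivial commutator of x generates N, a prime occurs in at most one pair of the second kind;
counting the products pq then bounds the number of primes and determines m and n.

In the case of three primes let {q, r} with q < r be the exceptional pair, N the resulting normal
subgroup of order r, and y of class size r. Then y acts nontrivially on N, and G is the product of
N <y> and K = C(N) \<inter> C(y). An element k of K and 1 \<noteq> n in N satisfy |(kn)^G| = q |k^K|, so
that K has only the class sizes 1 and p. Hence the p'-elements of K are central in it and
K = P x A with a p-group P, and G = P x (N <y> A).
*)

theory Submission
  imports Defs
begin

section \<open>Conjugation and orbits\<close>

text \<open>Normal subgroups come from one source. When the product class of \<open>x\<close> and
  \<open>y\<close> has the size q of the larger factor, every translate of y^G by a conjugate of
  \<open>x\<close> is equal to it. So quotients of conjugates of \<open>x\<close> translate y^G into
  itself, and the group of all such translations has prime order. Its automorphisms commute, which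
  ties its centralizer to that of \<open>x\<close>. The obstacle in the case of three primes is that
  K and N <y> are commuting factors that overlap: y^q lies in both. The remedy is to choose
  \<open>y\<close> of order prime to p, as a power of an element of class size r. This pushes the
  overlap into the p'-part A of K, and A is moved over to the second factor, which then meets P
  trivially. That \<open>y\<close> acts nontrivially on N rests on the fact that no class size in
  the list is divisible by r^2. The abelian factor of the theorem can be taken trivial: A stays in
  H, where, being central, it changes neither the class sizes nor H/Z(H).\<close>

definition conj_by :: "('a, 'b) monoid_scheme \<Rightarrow> 'a \<Rightarrow> 'a \<Rightarrow> 'a" where
  "conj_by G g x = g \<otimes>\<^bsub>G\<^esub> x \<otimes>\<^bsub>G\<^esub> inv\<^bsub>G\<^esub> g"

definition centralizer :: "('a, 'b) monoid_scheme \<Rightarrow> 'a \<Rightarrow> 'a set" where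
  "centralizer G x = {g \<in> carrier G. g \<otimes>\<^bsub>G\<^esub> x = x \<otimes>\<^bsub>G\<^esub> g}"

lemma conjugacy_class_eq:
  assumes "x \<in> carrier G"
  shows "conjugacy_class G x = (\<lambda>g. conj_by G g x) ` carrier G"
  using assms by (auto simp: conjugacy_class_def orbit_def conj_by_def)

lemma card_eq_fibre_mult:
  assumes "finite S" and "\<And>y. y \<in> f ` S \<Longrightarrow> card {x \<in> S. f x = y} = k"
  shows "card S = card (f ` S) * k"
proof -
  have "card S = (\<Sum>y\<in>f ` S. card {x \<in> S. f x = y})"
    using sum.group[of S "f ` S" f "\<lambda>_. 1::nat"] assms(1) by simp
  then show ?thesis using assms(2) by simp
qed

context group
begin

lemma conj_by_closed [simp]:
  "g \<in> carrier G \<Longrightarrow> x \<in> carrier G \<Longrightarrow> conj_by G g x \<in> carrier G"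
  by (simp add: conj_by_def)

lemma conj_by_mult:
  "g \<in> carrier G \<Longrightarrow> x \<in> carrier G \<Longrightarrow> y \<in> carrier G
    \<Longrightarrow> conj_by G g (x \<otimes> y) = conj_by G g x \<otimes> conj_by G g y"
  unfolding conj_by_def
  by (metis inv_closed inv_solve_left m_assoc m_closed)

lemma conj_by_comp:
  "g \<in> carrier G \<Longrightarrow> h \<in> carrier G \<Longrightarrow> x \<in> carrier G
    \<Longrightarrow> conj_by G (g \<otimes> h) x = conj_by G g (conj_by G h x)"
  by (simp add: conj_by_def m_assoc inv_mult_group)

lemma conj_by_one [simp]: "x \<in> carrier G \<Longrightarrow> conj_by G \<one> x = x"
  by (simp add: conj_by_def)

lemma conj_by_of_one [simp]: "g \<in> carrier G \<Longrightarrow> conj_by G g \<one> = \<one>"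
  by (simp add: conj_by_def)

lemma conj_by_inv_cancel [simp]:
  "g \<in> carrier G \<Longrightarrow> x \<in> carrier G \<Longrightarrow> conj_by G (inv g) (conj_by G g x) = x"
  "g \<in> carrier G \<Longrightarrow> x \<in> carrier G \<Longrightarrow> conj_by G g (conj_by G (inv g) x) = x"
  by (simp_all add: conj_by_comp[symmetric])

lemma conj_by_eq_iff:
  "g \<in> carrier G \<Longrightarrow> x \<in> carrier G \<Longrightarrow> y \<in> carrier G
    \<Longrightarrow> conj_by G g x = conj_by G g y \<longleftrightarrow> x = y"
  by (metis conj_by_inv_cancel(1))

lemma conj_by_inv:
  "g \<in> carrier G \<Longrightarrow> x \<in> carrier G \<Longrightarrow> conj_by G g (inv x) = inv (conj_by G g x)"
  by (simp add: conj_by_def m_assoc inv_mult_group)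

lemma conj_by_pow:
  "g \<in> carrier G \<Longrightarrow> x \<in> carrier G \<Longrightarrow> conj_by G g (x [^] (n::nat)) = conj_by G g x [^] n"
  by (induction n) (simp_all add: conj_by_mult)

lemma conj_by_fixed_iff:
  "g \<in> carrier G \<Longrightarrow> x \<in> carrier G \<Longrightarrow> conj_by G g x = x \<longleftrightarrow> g \<in> centralizer G x"
  unfolding conj_by_def centralizer_def
  using inv_solve_right'[of x "g \<otimes> x" g] by auto

lemma conj_by_fixed:
  "g \<in> centralizer G x \<Longrightarrow> x \<in> carrier G \<Longrightarrow> conj_by G g x = x"
  using conj_by_fixed_iff by (auto simp: centralizer_def)

lemma centralizer_sym:
  "g \<in> carrier G \<Longrightarrow> x \<in> carrier G \<Longrightarrow> g \<in> centralizer G x \<longleftrightarrow> x \<in> centralizer G g"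
  by (auto simp: centralizer_def)

lemma centralizer_carrier: "g \<in> centralizer G x \<Longrightarrow> g \<in> carrier G"
  by (simp add: centralizer_def)

lemma centralizer_subgroup:
  assumes "x \<in> carrier G"
  shows "subgroup (centralizer G x) G"
proof (rule subgroupI)
  show "centralizer G x \<subseteq> carrier G" by (auto simp: centralizer_def)
  show "centralizer G x \<noteq> {}" using assms by (auto simp: centralizer_def)
next
  fix a assume "a \<in> centralizer G x"
  then show "inv a \<in> centralizer G x"
    using assms by (metis (no_types, lifting) centralizer_carrier conj_by_fixed_iff
      conj_by_inv_cancel(1) inv_closed)
next
  fix a b assume "a \<in> centralizer G x" "b \<in> centralizer G x"
  then show "a \<otimes> b \<in> centralizer G x"
    using assms by (metis (no_types, lifting) centralizer_carrier conj_by_fixed_iff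
      conj_by_comp m_closed)
qed

lemma centralizer_self: "x \<in> carrier G \<Longrightarrow> x \<in> centralizer G x"
  by (simp add: centralizer_def)

lemma pow_in_subgroup:
  assumes "subgroup S G" "x \<in> S" shows "x [^] (n::nat) \<in> S"
  by (induction n) (use assms in \<open>auto intro: subgroup.m_closed subgroup.one_closed\<close>)

lemma centralizer_pow:
  assumes "x \<in> carrier G" "g \<in> centralizer G x" shows "g \<in> centralizer G (x [^] (n::nat))"
  using assms pow_in_subgroup[OF centralizer_subgroup, of g x n]
  by (meson centralizer_carrier centralizer_sym nat_pow_closed)

lemma centralizer_mult:
  assumes "x \<in> carrier G" "y \<in> carrier G" "g \<in> centralizer G x" "g \<in> centralizer G y"
  shows "g \<in> centralizer G (x \<otimes> y)"
  using assms by (metis centralizer_carrier conj_by_fixed_iff conj_by_mult m_closed)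

text \<open>Orbit-stabiliser for conjugation restricted to a subgroup: the fibre through
  \<open>g0\<close> is a left coset of \<open>S \<inter> centralizer G x\<close>. Small orbits of
  \<open>N\<close> and of centralizers are recognised through it later.\<close>

lemma card_orbit_subgroup:
  assumes "finite (carrier G)" "subgroup S G" "x \<in> carrier G"
  shows "card ((\<lambda>g. conj_by G g x) ` S) * card (S \<inter> centralizer G x) = card S"
proof -
  let ?f = "\<lambda>g. conj_by G g x"
  have S: "S \<subseteq> carrier G" using assms subgroup.subset by blast
  have "card {g \<in> S. ?f g = ?f g0} = card (S \<inter> centralizer G x)" if g0: "g0 \<in> S" for g0
  proof -
    have "{g \<in> S. ?f g = ?f g0} = (\<otimes>) g0 ` (S \<inter> centralizer G x)"
    proof
      show "(\<otimes>) g0 ` (S \<inter> centralizer G x) \<subseteq> {g \<in> S. ?f g = ?f g0}"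
      proof
        fix z assume "z \<in> (\<otimes>) g0 ` (S \<inter> centralizer G x)"
        then obtain d where d: "z = g0 \<otimes> d" "d \<in> S" "d \<in> centralizer G x" by blast
        have "d \<in> carrier G" "g0 \<in> carrier G" using d g0 S by auto
        then have "?f z = ?f g0"
          unfolding d(1) using d(3) assms(3) by (simp add: conj_by_comp conj_by_fixed)
        then show "z \<in> {g \<in> S. ?f g = ?f g0}"
          using d g0 assms(2) by (simp add: subgroup.m_closed)
      qed
      show "{g \<in> S. ?f g = ?f g0} \<subseteq> (\<otimes>) g0 ` (S \<inter> centralizer G x)"
      proof
        fix g assume g: "g \<in> {g \<in> S. ?f g = ?f g0}"
        then have gS: "g \<in> S" "g \<in> carrier G" "g0 \<in> carrier G" using S g0 by auto
        have "conj_by G (inv g0 \<otimes> g) x = x"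
          using g gS assms by (simp add: conj_by_comp)
        then have "inv g0 \<otimes> g \<in> S \<inter> centralizer G x"
          using gS g0 assms by (simp add: conj_by_fixed_iff subgroup.m_closed subgroup.m_inv_closed)
        moreover have "g = g0 \<otimes> (inv g0 \<otimes> g)"
          using gS by (simp add: m_assoc[symmetric])
        ultimately show "g \<in> (\<otimes>) g0 ` (S \<inter> centralizer G x)" by blast
      qed
    qed
    moreover have "inj_on ((\<otimes>) g0) (S \<inter> centralizer G x)"
      using S g0 by (intro inj_onI) (metis IntD1 l_cancel subsetD)
    ultimately show ?thesis by (simp add: card_image)
  qed
  then have "card S = card (?f ` S) * card (S \<inter> centralizer G x)"
    using S assms(1) by (intro card_eq_fibre_mult) (auto intro: finite_subset)
  then show ?thesis by simp
qed

lemma card_class_mult_centralizer: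
  assumes "finite (carrier G)" "x \<in> carrier G"
  shows "card (conjugacy_class G x) * card (centralizer G x) = card (carrier G)"
  using card_orbit_subgroup[OF assms(1) subgroup_self assms(2)]
  by (simp add: conjugacy_class_eq[OF assms(2)] Int_absorb1 centralizer_carrier subset_iff)

lemma card_subgroup_dvd:
  assumes "subgroup H G" "subgroup S G" "H \<subseteq> S"
  shows "card H dvd card S"
proof -
  have "group (G\<lparr>carrier := S\<rparr>)" using assms subgroup.subgroup_is_group is_group by blast
  moreover have "subgroup H (G\<lparr>carrier := S\<rparr>)"
    using assms subgroup_incl by blast
  ultimately have "card (rcosets\<^bsub>G\<lparr>carrier := S\<rparr>\<^esub> H) * card H = order (G\<lparr>carrier := S\<rparr>)"
    using group.lagrange by blast
  then show ?thesis by (metis dvd_triv_right order_def partial_object.simps(1)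
        partial_object.update_convs(1) partial_object.surjective)
qed

lemma subgroup_card_pos:
  assumes "finite (carrier G)" "subgroup S G" shows "card S > 0"
  using assms by (metis card_gt_0_iff empty_iff finite_subset subgroup.one_closed subgroup.subset)

text \<open>The index of \<open>S\<close> divides \<open>q\<close> and is not \<open>q\<close>. It
  serves to show that a subgroup of prime index together with one outside element gives the whole
  group, and that such a subgroup is its own normalizer unless it is normal.\<close>

lemma subgroup_prime_index_maximal:
  assumes fin: "finite (carrier G)" and C: "subgroup C G" and S: "subgroup S G" "C \<subseteq> S" "C \<noteq> S"
    and q: "card (carrier G) = q * card C" "Factorial_Ring.prime (q::nat)"
  shows "S = carrier G"
proof -
  obtain a where a: "card S = card C * a" using card_subgroup_dvd[OF C S(1,2)] by blast
  obtain b where b: "card (carrier G) = card S * b"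
    using card_subgroup_dvd[OF S(1) subgroup_self] S(1) subgroup.subset by blast
  have pos: "card C > 0" using subgroup_card_pos fin C by blast
  have "card C * q = card C * (a * b)" using a b q by (simp add: ac_simps)
  then have ab: "q = a * b" using pos by simp
  have "finite S" using finite_subset[OF subgroup.subset[OF S(1)] fin] .
  then have "card C \<noteq> card S" using S card_subset_eq by metis
  then have "a \<noteq> 1" using a by simp
  moreover have "a = 1 \<or> b = 1" using q(2) unfolding ab by (rule prime_product)
  ultimately have "b = 1" by simp
  then show ?thesis using b card_subset_eq[OF fin] S(1) subgroup.subset by (metis mult.right_neutral)
qed

text \<open>The product set need not be a subgroup, so it is counted by fibres: the factorizations
  of \<open>h \<otimes> k\<close> are (h d, d^-1 k) with \<open>d\<close> in the
  intersection.\<close>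

lemma card_set_mult:
  assumes fin: "finite (carrier G)" and H: "subgroup H G" and K: "subgroup K G"
  shows "card (H <#> K) * card (H \<inter> K) = card H * card K"
proof -
  let ?f = "\<lambda>(h, k). h \<otimes> k"
  have HK: "H \<subseteq> carrier G" "K \<subseteq> carrier G" using H K subgroup.subset by auto
  have img: "H <#> K = ?f ` (H \<times> K)" by (auto simp: set_mult_def)
  have "card {z \<in> H \<times> K. ?f z = h \<otimes> k} = card (H \<inter> K)" if hk: "h \<in> H" "k \<in> K" for h k
  proof -
    have c: "h \<in> carrier G" "k \<in> carrier G" using hk HK by auto
    have "{z \<in> H \<times> K. ?f z = h \<otimes> k} = (\<lambda>d. (h \<otimes> d, inv d \<otimes> k)) ` (H \<inter> K)"
    proof
      show "(\<lambda>d. (h \<otimes> d, inv d \<otimes> k)) ` (H \<inter> K) \<subseteq> {z \<in> H \<times> K. ?f z = h \<otimes> k}"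
      proof
        fix z assume "z \<in> (\<lambda>d. (h \<otimes> d, inv d \<otimes> k)) ` (H \<inter> K)"
        then obtain d where d: "d \<in> H" "d \<in> K" "z = (h \<otimes> d, inv d \<otimes> k)" by blast
        moreover have "d \<in> carrier G" using d HK by auto
        then have "h \<otimes> d \<otimes> (inv d \<otimes> k) = h \<otimes> k"
          using c by (metis inv_closed m_assoc m_closed inv_solve_left)
        ultimately show "z \<in> {z \<in> H \<times> K. ?f z = h \<otimes> k}"
          using hk H K by (auto simp: subgroup.m_closed subgroup.m_inv_closed)
      qed
      show "{z \<in> H \<times> K. ?f z = h \<otimes> k} \<subseteq> (\<lambda>d. (h \<otimes> d, inv d \<otimes> k)) ` (H \<inter> K)"
      proof
        fix z assume "z \<in> {z \<in> H \<times> K. ?f z = h \<otimes> k}"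
        then obtain a b where ab: "z = (a, b)" "a \<in> H" "b \<in> K" "a \<otimes> b = h \<otimes> k" by auto
        have abc: "a \<in> carrier G" "b \<in> carrier G" using ab HK by auto
        define d where "d = inv h \<otimes> a"
        have dc: "d \<in> carrier G" unfolding d_def using c abc by simp
        have "d \<otimes> b = k" unfolding d_def using ab(4) c abc
          by (metis inv_closed inv_solve_left m_assoc m_closed)
        then have d2: "d = k \<otimes> inv b" using c abc dc by (metis inv_solve_right)
        have "d \<in> H" unfolding d_def using ab hk H by (simp add: subgroup.m_closed subgroup.m_inv_closed)
        moreover have "d \<in> K" unfolding d2 using ab hk K by (simp add: subgroup.m_closed subgroup.m_inv_closed)
        moreover have "a = h \<otimes> d" unfolding d_def using c abc by (simp add: m_assoc[symmetric])
        moreover have "b = inv d \<otimes> k" using \<open>d \<otimes> b = k\<close> c abc dc by (metis inv_solve_left)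
        ultimately show "z \<in> (\<lambda>d. (h \<otimes> d, inv d \<otimes> k)) ` (H \<inter> K)" using ab(1) by blast
      qed
    qed
    moreover have "inj_on (\<lambda>d. (h \<otimes> d, inv d \<otimes> k)) (H \<inter> K)"
      using c HK by (intro inj_onI) (metis (no_types, lifting) IntD1 fst_conv l_cancel subsetD)
    ultimately show ?thesis by (simp add: card_image)
  qed
  then have "card (H \<times> K) = card (?f ` (H \<times> K)) * card (H \<inter> K)"
    using HK fin by (intro card_eq_fibre_mult) (auto intro: finite_subset)
  then show ?thesis by (simp add: img card_cartesian_product)
qed

end

section \<open>Classes of coprime size\<close>

lemma dvd_prime_mult_cases:
  fixes p q d :: nat
  assumes "Factorial_Ring.prime p" "Factorial_Ring.prime q" "d dvd p * q"
  shows "d = 1 \<or> d = p \<or> d = q \<or> d = p * q"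
proof -
  obtain a b where "d = a * b" "a dvd p" "b dvd q" using assms(3) by (rule dvd_productE)
  moreover have "a = 1 \<or> a = p" "b = 1 \<or> b = q"
    using calculation assms(1,2) by (auto simp: prime_nat_iff)
  ultimately show ?thesis by auto
qed

context group
begin

text \<open>By Lagrange's theorem a nontrivial element already generates \<open>N\<close>. The form
  with powers is convenient because conjugation passes through powers: its effect on
  \<open>N\<close> is determined by the image of \<open>u\<close>.\<close>

lemma prime_order_powers:
  assumes fin: "finite (carrier G)" and N: "subgroup N G"
    and q: "card N = q" "Factorial_Ring.prime (q::nat)" and u: "u \<in> N" "u \<noteq> \<one>" and n: "n \<in> N"
  shows "\<exists>i::nat. n = u [^] i"
proof -
  have uc: "u \<in> carrier G" using u N subgroup.subset by blast
  let ?S = "generate G {u}"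
  have S: "?S = {u [^] k | k. k \<in> (UNIV :: nat set)}"
    using generate_pow_on_finite_carrier[OF fin uc] .
  have sub: "?S \<subseteq> N" using generate_subgroup_incl[of "{u}" N] u N by blast
  have Ssub: "subgroup ?S G" using generate_is_subgroup uc by blast
  have "card ?S dvd q" using card_subgroup_dvd[OF Ssub N sub] q by simp
  then have "card ?S = 1 \<or> card ?S = q" using q(2) by (simp add: prime_nat_iff)
  moreover have "card ?S \<noteq> 1"
  proof
    assume "card ?S = 1"
    then obtain z where "?S = {z}" by (rule card_1_singletonE)
    moreover have "u \<in> ?S" by (simp add: generate.incl)
    moreover have "\<one> \<in> ?S" by (rule generate.one)
    ultimately show False using u(2) by simp
  qed
  ultimately have "card ?S = card N" using q by simp
  moreover have "finite N" using finite_subset[OF subgroup.subset[OF N] fin] .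
  ultimately have "?S = N" using card_subset_eq sub by metis
  then show ?thesis using S n by auto
qed

lemma prime_order_subset:
  assumes "finite (carrier G)" "subgroup N G" "card N = q" "Factorial_Ring.prime (q::nat)"
    "u \<in> N" "u \<noteq> \<one>" "subgroup S G" "u \<in> S"
  shows "N \<subseteq> S"
  using prime_order_powers[OF assms(1-6)] pow_in_subgroup[OF assms(7,8)] by blast

lemma conjugacy_classI:
  "x \<in> carrier G \<Longrightarrow> g \<in> carrier G \<Longrightarrow> conj_by G g x \<in> conjugacy_class G x"
  by (simp add: conjugacy_class_eq)

lemma conjugacy_classE:
  assumes "y \<in> conjugacy_class G x" "x \<in> carrier G"
  obtains g where "g \<in> carrier G" "y = conj_by G g x"
  using assms by (auto simp: conjugacy_class_eq)

lemma conjugacy_class_self: "x \<in> carrier G \<Longrightarrow> x \<in> conjugacy_class G x"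
  using conjugacy_classI[of x \<one>] by simp

lemma conjugacy_class_carrier: "x \<in> carrier G \<Longrightarrow> conjugacy_class G x \<subseteq> carrier G"
  by (auto simp: conjugacy_class_eq)

lemma conjugacy_class_closed:
  assumes "y \<in> conjugacy_class G x" "x \<in> carrier G" "g \<in> carrier G"
  shows "conj_by G g y \<in> conjugacy_class G x"
  using assms by (metis conj_by_comp conjugacy_classE conjugacy_classI m_closed)

lemma finite_conjugacy_class:
  "finite (carrier G) \<Longrightarrow> x \<in> carrier G \<Longrightarrow> finite (conjugacy_class G x)"
  by (simp add: conjugacy_class_eq)

lemma class_size_dvd:
  assumes "finite (carrier G)" "x \<in> carrier G" "y \<in> carrier G"
    "centralizer G x \<subseteq> centralizer G y"
  shows "card (conjugacy_class G y) dvd card (conjugacy_class G x)"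
proof -
  obtain t where t: "card (centralizer G y) = card (centralizer G x) * t"
    using card_subgroup_dvd[OF centralizer_subgroup centralizer_subgroup] assms by blast
  have "card (conjugacy_class G x) * card (centralizer G x)
      = card (conjugacy_class G y) * t * card (centralizer G x)"
    using card_class_mult_centralizer[OF assms(1,2)] card_class_mult_centralizer[OF assms(1,3)] t
    by (metis mult.assoc mult.commute)
  moreover have "card (centralizer G x) > 0"
    using subgroup_card_pos assms centralizer_subgroup by blast
  ultimately show ?thesis by simp
qed

lemma class_size_one_iff:
  assumes "finite (carrier G)" "x \<in> carrier G"
  shows "card (conjugacy_class G x) = 1 \<longleftrightarrow> (\<forall>g\<in>carrier G. g \<in> centralizer G x)"
proof
  assume "card (conjugacy_class G x) = 1"
  then obtain z where "conjugacy_class G x = {z}" by (rule card_1_singletonE)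
  then have "conj_by G g x = x" if "g \<in> carrier G" for g
    using conjugacy_classI[OF assms(2) that] conjugacy_class_self[OF assms(2)] by simp
  then show "\<forall>g\<in>carrier G. g \<in> centralizer G x" using conj_by_fixed_iff assms(2) by blast
next
  assume "\<forall>g\<in>carrier G. g \<in> centralizer G x"
  then have "conjugacy_class G x = {x}"
    using assms by (auto simp: conjugacy_class_eq conj_by_fixed)
  then show "card (conjugacy_class G x) = 1" by simp
qed

text \<open>Both class sizes divide the index of the intersection, hence so does their product. The
  product formula then makes the cardinality of the product set a positive multiple of the group
  order.\<close>

lemma coprime_index_centralizers:
  assumes fin: "finite (carrier G)" and x: "x \<in> carrier G" and y: "y \<in> carrier G"
    and cop: "coprime (card (conjugacy_class G x)) (card (conjugacy_class G y))"
  shows "centralizer G x <#> centralizer G y = carrier G"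
    and "card (conjugacy_class G x) * card (conjugacy_class G y)
       * card (centralizer G x \<inter> centralizer G y) = card (carrier G)"
proof -
  let ?X = "centralizer G x" and ?Y = "centralizer G y"
  define a b i n where "a = card (conjugacy_class G x)" "b = card (conjugacy_class G y)"
    "i = card (?X \<inter> ?Y)" "n = card (carrier G)"
  note defs = this
  have X: "subgroup ?X G" and Y: "subgroup ?Y G" using centralizer_subgroup x y by auto
  have I: "subgroup (?X \<inter> ?Y) G" using subgroups_Inter_pair X Y by blast
  have i: "i > 0" and npos: "n > 0" using subgroup_card_pos fin I subgroup_self by (auto simp: defs)
  have ax: "a * card ?X = n" "b * card ?Y = n"
    using card_class_mult_centralizer fin x y by (auto simp: defs)
  obtain s where s: "card ?X = i * s" using card_subgroup_dvd[OF I X] by (auto simp: defs)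
  obtain s' where s': "card ?Y = i * s'" using card_subgroup_dvd[OF I Y] by (auto simp: defs)
  \<comment> \<open>\<open>m\<close> is the index of the intersection; what has to be shown is that
    \<open>t = 1\<close> in \<open>m = a * b * t\<close>.\<close>
  obtain m where m: "n = i * m" "m = a * s" using ax s by (metis mult.left_commute)
  have "m = b * s'" using ax s' m i by (metis mult.left_commute mult_left_cancel not_gr_zero)
  then have "a * b dvd m" using m cop by (metis defs(1,2) divides_mult dvd_triv_left)
  then obtain t where t: "m = a * b * t" by blast
  have "card (?X <#> ?Y) * i = card ?X * card ?Y"
    using card_set_mult[OF fin X Y] by (simp add: defs)
  then have "a * b * (card (?X <#> ?Y) * i) = a * card ?X * (b * card ?Y)" by (simp add: ac_simps)
  also have "\<dots> = n * n" using ax by simp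
  also have "\<dots> = a * b * (n * t * i)" using m(1) t by (simp add: ac_simps)
  finally have "card (?X <#> ?Y) = n * t"
    using i npos ax by (metis mult_cancel_right mult_eq_0_iff mult_left_cancel not_gr_zero)
  moreover have sub: "?X <#> ?Y \<subseteq> carrier G"
    using setmult_subset_G X Y subgroup.subset by metis
  then have "card (?X <#> ?Y) \<le> n" using card_mono[OF fin] by (simp add: defs)
  moreover have "t > 0" using t m npos by (cases t) auto
  ultimately have t1: "t = 1 \<and> card (?X <#> ?Y) = n" using npos
    by (metis One_nat_def Suc_leI le_antisym mult.right_neutral mult_le_cancel1 mult_le_mono2)
  then show "?X <#> ?Y = carrier G" using card_subset_eq[OF fin sub] by (simp add: defs)
  show "card (conjugacy_class G x) * card (conjugacy_class G y) * card (?X \<inter> ?Y)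
      = card (carrier G)"
    using m(1) t t1 unfolding defs[symmetric] by simp
qed

text \<open>Since \<open>G = C(x) C(y)\<close>, the group acts transitively on pairs of conjugates.\<close>

lemma coprime_classes_mult:
  assumes fin: "finite (carrier G)" and x: "x \<in> carrier G" and y: "y \<in> carrier G"
    and cop: "coprime (card (conjugacy_class G x)) (card (conjugacy_class G y))"
    and a: "a \<in> conjugacy_class G x" and b: "b \<in> conjugacy_class G y"
  shows "a \<otimes> b \<in> conjugacy_class G (x \<otimes> y)"
proof -
  obtain g where g: "g \<in> carrier G" "a = conj_by G g x" using a x by (rule conjugacy_classE)
  obtain h where h: "h \<in> carrier G" "b = conj_by G h y" using b y by (rule conjugacy_classE)
  \<comment> \<open>Splitting the quotient of the two conjugators provides the common conjugator
    \<open>g \<otimes> c\<close>: \<open>c\<close> fixes \<open>x\<close>, and \<open>d\<close>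
    fixes \<open>y\<close>.\<close>
  have "inv g \<otimes> h \<in> centralizer G x <#> centralizer G y"
    using coprime_index_centralizers(1)[OF fin x y cop] g h by simp
  then obtain c d where cd: "c \<in> centralizer G x" "d \<in> centralizer G y" "inv g \<otimes> h = c \<otimes> d"
    by (auto simp: set_mult_def)
  have cdc: "c \<in> carrier G" "d \<in> carrier G" using cd centralizer_carrier by auto
  have hg: "h = g \<otimes> c \<otimes> d" using cd(3) cdc g h by (metis inv_closed inv_solve_left m_assoc m_closed)
  have "conj_by G h y = conj_by G (g \<otimes> c) y"
    unfolding hg using cdc g y cd(2) by (simp add: conj_by_comp conj_by_fixed)
  moreover have "conj_by G g x = conj_by G (g \<otimes> c) x"
    using cdc g x cd(1) by (simp add: conj_by_comp conj_by_fixed)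
  ultimately have "a \<otimes> b = conj_by G (g \<otimes> c) (x \<otimes> y)"
    using g h x y cdc by (simp add: conj_by_mult)
  then show ?thesis using conjugacy_classI x y g cdc by simp
qed

text \<open>The intersection of the two centralizers has the product of the class sizes as its
  index, and it lies in the centralizer of \<open>x \<otimes> y\<close>.\<close>

lemma class_size_mult_dvd:
  assumes fin: "finite (carrier G)" and x: "x \<in> carrier G" and y: "y \<in> carrier G"
    and cop: "coprime (card (conjugacy_class G x)) (card (conjugacy_class G y))"
  shows "card (conjugacy_class G (x \<otimes> y))
    dvd card (conjugacy_class G x) * card (conjugacy_class G y)"
proof -
  let ?I = "centralizer G x \<inter> centralizer G y"
  have I: "subgroup ?I G" using subgroups_Inter_pair centralizer_subgroup x y by blast
  have "?I \<subseteq> centralizer G (x \<otimes> y)" using centralizer_mult x y by blast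
  then obtain t where "card (centralizer G (x \<otimes> y)) = card ?I * t"
    using card_subgroup_dvd[OF I centralizer_subgroup[of "x \<otimes> y"]] x y by blast
  then have "card (conjugacy_class G (x \<otimes> y)) * t * card ?I
    = card (conjugacy_class G x) * card (conjugacy_class G y) * card ?I"
    using card_class_mult_centralizer[OF fin, of "x \<otimes> y"] x y
      coprime_index_centralizers(2)[OF fin x y cop] by (simp add: ac_simps)
  moreover have "card ?I > 0" using subgroup_card_pos fin I by blast
  ultimately show ?thesis by (metis dvd_triv_left mult_cancel_right not_gr_zero)
qed

section \<open>Exceptional pairs: the normal subgroup of translations of a class\<close>

lemma card_r_coset:
  assumes "N \<subseteq> carrier G" "x \<in> carrier G" shows "card (N #> x) = card N"
  using card_cosets_equal[OF rcosetsI[OF assms] assms(1)] bij_betw_same_card by metis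

lemma normal_conj_by:
  assumes "N \<lhd> G" "n \<in> N" "g \<in> carrier G" shows "conj_by G g n \<in> N"
  using assms normal.inv_op_closed2 unfolding conj_by_def by metis

lemma normalI_conj_by:
  assumes "subgroup N G" "\<And>g n. g \<in> carrier G \<Longrightarrow> n \<in> N \<Longrightarrow> conj_by G g n \<in> N"
  shows "N \<lhd> G"
  using assms unfolding normal_inv_iff conj_by_def by blast

text \<open>Each conjugation by \<open>g\<close> contributes one further factor \<open>c\<close> and
  leaves the earlier ones alone. So the powers of \<open>g\<close> carry \<open>x\<close> through
  its coset by the group generated by \<open>c\<close>.\<close>

lemma conj_by_pow_left_commuting:
  assumes g: "g \<in> carrier G" and x: "x \<in> carrier G" and c: "c \<in> carrier G"
    and gx: "conj_by G g x = x \<otimes> c" and gc: "g \<in> centralizer G c"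
  shows "conj_by G (g [^] (i::nat)) x = x \<otimes> c [^] i"
proof (induction i)
  case 0
  then show ?case using x by simp
next
  case (Suc i)
  have "conj_by G (g [^] Suc i) x = conj_by G g (conj_by G (g [^] i) x)"
    using g x by (simp only: nat_pow_Suc2 conj_by_comp nat_pow_closed)
  also have "\<dots> = conj_by G g x \<otimes> conj_by G g (c [^] i)"
    using Suc g x c by (simp add: conj_by_mult)
  also have "conj_by G g (c [^] i) = c [^] i"
    using centralizer_pow[OF c gc] conj_by_fixed c by simp
  finally show ?case using gx x c by (simp only: nat_pow_Suc2 m_assoc nat_pow_closed)
qed

text \<open>\<open>N\<close> is the stabiliser of the class under left translation. A class is
  invariant under conjugation, which makes \<open>N\<close> normal, and it is a union of right
  cosets of \<open>N\<close>, which gives the divisibility.\<close>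

lemma class_translations_normal:
  assumes fin: "finite (carrier G)" and y: "y \<in> carrier G"
  defines "N \<equiv> {g \<in> carrier G. \<forall>b \<in> conjugacy_class G y. g \<otimes> b \<in> conjugacy_class G y}"
  shows "N \<lhd> G" and "card N dvd card (conjugacy_class G y)"
proof -
  let ?B = "conjugacy_class G y"
  have Bc: "?B \<subseteq> carrier G" using conjugacy_class_carrier y by blast
  have Bf: "finite ?B" using finite_conjugacy_class fin y by blast
  have sub: "subgroup N G"
  proof (rule subgroupI)
    show "N \<subseteq> carrier G" by (auto simp: N_def)
    have "\<one> \<otimes> b = b" if "b \<in> ?B" for b using l_one Bc that by blast
    then have "\<one> \<in> N" by (simp add: N_def)
    then show "N \<noteq> {}" by blast
  next
    fix g assume "g \<in> N"
    then have g: "g \<in> carrier G" "\<And>b. b \<in> ?B \<Longrightarrow> g \<otimes> b \<in> ?B" by (auto simp: N_def)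
    \<comment> \<open>Translation by \<open>g\<close> is an injection of a finite set into itself,
      hence onto; this yields closure under inverses.\<close>
    have "inj_on ((\<otimes>) g) ?B" using Bc g(1) by (intro inj_onI) (metis l_cancel subsetD)
    moreover have "(\<otimes>) g ` ?B \<subseteq> ?B" using g by auto
    ultimately have surj: "(\<otimes>) g ` ?B = ?B" using endo_inj_surj Bf by blast
    have "inv g \<otimes> b \<in> ?B" if "b \<in> ?B" for b
    proof -
      have "b \<in> (\<otimes>) g ` ?B" using surj that by simp
      then obtain b' where b': "b = g \<otimes> b'" "b' \<in> ?B" by (rule imageE)
      moreover have "b' \<in> carrier G" using b' Bc by blast
      ultimately show ?thesis using g(1) by (simp add: m_assoc[symmetric])
    qed
    then show "inv g \<in> N" using g by (simp add: N_def)
  next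
    fix g h assume gh: "g \<in> N" "h \<in> N"
    then have c: "g \<in> carrier G" "h \<in> carrier G" by (auto simp: N_def)
    have "g \<otimes> h \<otimes> b \<in> ?B" if b: "b \<in> ?B" for b
    proof -
      have "b \<in> carrier G" using b Bc by blast
      then show ?thesis using gh b c by (simp add: N_def m_assoc)
    qed
    then show "g \<otimes> h \<in> N" using c by (simp add: N_def)
  qed
  show norm: "N \<lhd> G"
  proof (rule normalI_conj_by[OF sub])
    fix h g assume h: "h \<in> carrier G" and g: "g \<in> N"
    have gc: "g \<in> carrier G" using g by (simp add: N_def)
    have "conj_by G h g \<otimes> b \<in> ?B" if b: "b \<in> ?B" for b
    proof -
      have bc: "b \<in> carrier G" using b Bc by blast
      have "conj_by G h g \<otimes> b = conj_by G h (g \<otimes> conj_by G (inv h) b)"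
        using h gc bc by (simp add: conj_by_mult)
      moreover have "g \<otimes> conj_by G (inv h) b \<in> ?B"
        using g conjugacy_class_closed[OF b y, of "inv h"] h by (simp add: N_def)
      ultimately show ?thesis using conjugacy_class_closed[OF _ y h] by simp
    qed
    then show "conj_by G h g \<in> N" using h gc by (simp add: N_def)
  qed
  have Nc: "N \<subseteq> carrier G" by (auto simp: N_def)
  have "card {b \<in> ?B. N #> b = N #> b0} = card N" if b0: "b0 \<in> ?B" for b0
  proof -
    have b0c: "b0 \<in> carrier G" using b0 Bc by blast
    have "{b \<in> ?B. N #> b = N #> b0} = N #> b0"
    proof
      show "{b \<in> ?B. N #> b = N #> b0} \<subseteq> N #> b0"
      proof
        fix b assume b: "b \<in> {b \<in> ?B. N #> b = N #> b0}"
        then have "b \<in> carrier G" using Bc by blast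
        then show "b \<in> N #> b0" using b rcos_self[OF _ sub] by auto
      qed
      show "N #> b0 \<subseteq> {b \<in> ?B. N #> b = N #> b0}"
      proof
        fix b assume b: "b \<in> N #> b0"
        then have "N #> b0 = N #> b" using repr_independence[OF b b0c sub] by simp
        moreover have "b \<in> ?B" using b b0 by (auto simp: r_coset_def N_def)
        ultimately show "b \<in> {b \<in> ?B. N #> b = N #> b0}" by simp
      qed
    qed
    then show ?thesis
      using card_r_coset[OF Nc b0c] by simp
  qed
  then have "card ?B = card ((\<lambda>b. N #> b) ` ?B) * card N"
    using Bf by (intro card_eq_fibre_mult) auto
  then show "card N dvd card ?B" by simp
qed

text \<open>The subgroup usually written C_G(N) appears below as
  \<open>{g \<in> carrier G. centralizes g N}\<close>.\<close>

definition centralizes :: "'a \<Rightarrow> 'a set \<Rightarrow> bool" where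
  "centralizes g N \<longleftrightarrow> (\<forall>n\<in>N. g \<in> centralizer G n)"

text \<open>The automorphism group of a cyclic group is abelian, so commutators act trivially on \<open>N\<close>.\<close>

lemma commutator_centralizes_prime_order:
  assumes fin: "finite (carrier G)" and N: "N \<lhd> G"
    and q: "card N = q" "Factorial_Ring.prime (q::nat)"
    and g: "g \<in> carrier G" and h: "h \<in> carrier G" and n: "n \<in> N"
  shows "conj_by G g (conj_by G h n) = conj_by G h (conj_by G g n)"
proof (cases "n = \<one>")
  case True
  then show ?thesis using g h by simp
next
  case False
  have Ns: "subgroup N G" using N normal_imp_subgroup by blast
  have nc: "n \<in> carrier G" using Ns n subgroup.subset by blast
  obtain i j :: nat where ij: "conj_by G g n = n [^] i" "conj_by G h n = n [^] j"
    using prime_order_powers[OF fin Ns q n False] normal_conj_by[OF N n] g h by metis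
  have "conj_by G g (conj_by G h n) = (n [^] i) [^] j"
    using ij g nc by (simp add: conj_by_pow)
  also have "\<dots> = (n [^] j) [^] i" using nc by (simp add: nat_pow_pow mult.commute)
  also have "\<dots> = conj_by G h (conj_by G g n)" using ij h nc by (simp add: conj_by_pow)
  finally show ?thesis .
qed

text \<open>The product class contains a translate of the class of \<open>y\<close>, the larger of
  the two, so if its size is not \<open>p * q\<close>, it equals every such translate.
  \<open>N\<close> consists of the translations that stabilise the class of \<open>y\<close>; its
  order divides \<open>q\<close>, and it contains all commutators of \<open>x\<close>, some of them
  nontrivial.\<close>

lemma small_coprime_classes:
  assumes fin: "finite (carrier G)" and x: "x \<in> carrier G" and y: "y \<in> carrier G"
    and p: "Factorial_Ring.prime (p::nat)" "card (conjugacy_class G x) = p"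
    and q: "Factorial_Ring.prime (q::nat)" "card (conjugacy_class G y) = q"
    and pq: "p < q" "card (conjugacy_class G (x \<otimes> y)) \<noteq> p * q"
  obtains N where "N \<lhd> G" "card N = q"
    "\<And>g. g \<in> carrier G \<Longrightarrow> inv x \<otimes> conj_by G g x \<in> N"
    "conjugacy_class G y = N #> y"
    "\<And>g. g \<in> carrier G \<Longrightarrow> centralizes g N \<longleftrightarrow> g \<in> centralizer G x"
proof -
  let ?A = "conjugacy_class G x" and ?B = "conjugacy_class G y"
    and ?D = "conjugacy_class G (x \<otimes> y)"
  define N where "N = {g \<in> carrier G. \<forall>b \<in> ?B. g \<otimes> b \<in> ?B}"
  have cop: "coprime (card ?A) (card ?B)" using p q pq by (simp add: primes_coprime)
  have Ac: "?A \<subseteq> carrier G" and Bc: "?B \<subseteq> carrier G" and Bf: "finite ?B" and Df: "finite ?D"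
    and Af: "finite ?A"
    using conjugacy_class_carrier finite_conjugacy_class fin x y by auto
  have AB: "a \<otimes> b \<in> ?D" if "a \<in> ?A" "b \<in> ?B" for a b
    using coprime_classes_mult[OF fin x y cop that] .
  have translate: "card ((\<otimes>) a ` ?B) = q" if "a \<in> ?A" for a
    using that Ac Bc q by (subst card_image) (auto intro!: inj_onI simp: subset_iff)
  \<comment> \<open>Of the divisors of \<open>p * q\<close> only \<open>q\<close> is left:
    \<open>p * q\<close> is excluded by hypothesis, and 1 and \<open>p\<close> are smaller than a
    translate of the class of \<open>y\<close>.\<close>
  have Dq: "card ?D = q"
  proof -
    have "card ?D dvd p * q" using class_size_mult_dvd[OF fin x y cop] p q by simp
    then have "card ?D = 1 \<or> card ?D = p \<or> card ?D = q"
      using dvd_prime_mult_cases p(1) q(1) pq(2) by blast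
    moreover have "q \<le> card ?D"
      using translate[OF conjugacy_class_self[OF x]] AB[OF conjugacy_class_self[OF x]]
        card_mono[OF Df, of "(\<otimes>) x ` ?B"] by auto
    ultimately show ?thesis using pq(1) q(1) prime_gt_1_nat by fastforce
  qed
  \<comment> \<open>Both \<open>a\<close> and \<open>a'\<close> translate the class of
    \<open>y\<close> onto the whole of \<open>?D\<close>.\<close>
  have AN: "inv a \<otimes> a' \<in> N" if a: "a \<in> ?A" "a' \<in> ?A" for a a'
  proof -
    have ac: "a \<in> carrier G" "a' \<in> carrier G" using a Ac by auto
    have "(\<otimes>) a ` ?B \<subseteq> ?D" using AB a(1) by auto
    then have D: "(\<otimes>) a ` ?B = ?D" using card_subset_eq[OF Df] Dq translate[OF a(1)] by simp
    have "inv a \<otimes> a' \<otimes> b \<in> ?B" if b: "b \<in> ?B" for b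
    proof -
      have "a' \<otimes> b \<in> (\<otimes>) a ` ?B" using AB[OF a(2) b] D by simp
      then obtain b' where b': "a' \<otimes> b = a \<otimes> b'" "b' \<in> ?B" by (rule imageE)
      have "b \<in> carrier G" "b' \<in> carrier G" using b b' Bc by auto
      then have "inv a \<otimes> a' \<otimes> b = b'"
        using b'(1) ac by (metis inv_closed inv_solve_left' m_assoc m_closed)
      then show ?thesis using b' by simp
    qed
    then show ?thesis using ac by (simp add: N_def)
  qed
  have N: "N \<lhd> G" and Ndvd: "card N dvd q"
    using class_translations_normal[OF fin y] q(2) by (auto simp: N_def)
  have Ns: "subgroup N G" using N normal_imp_subgroup by blast
  have Nc: "N \<subseteq> carrier G" by (auto simp: N_def)
  have comN: "inv x \<otimes> conj_by G g x \<in> N" if "g \<in> carrier G" for g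
    using AN[OF conjugacy_class_self[OF x] conjugacy_classI[OF x that]] .
  have "\<exists>g\<in>carrier G. g \<notin> centralizer G x"
    using class_size_one_iff[OF fin x] p prime_gt_1_nat by fastforce
  then obtain h where h: "h \<in> carrier G" "conj_by G h x \<noteq> x"
    using conj_by_fixed_iff x by blast
  define c where "c = inv x \<otimes> conj_by G h x"
  have cN: "c \<in> N" using comN h c_def by simp
  have cc: "c \<in> carrier G" using cN Nc by blast
  have hx: "conj_by G h x = x \<otimes> c" unfolding c_def using x h by (simp add: m_assoc[symmetric])
  have c1: "c \<noteq> \<one>" using hx h x by auto
  have "card N \<noteq> 1"
  proof
    assume "card N = 1"
    then obtain z where "N = {z}" by (rule card_1_singletonE)
    then show False using cN c1 subgroup.one_closed[OF Ns] by auto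
  qed
  then have Nq: "card N = q" using Ndvd q(1) by (auto simp: prime_nat_iff)
  have By: "?B = N #> y"
  proof -
    have "N #> y \<subseteq> ?B" using conjugacy_class_self[OF y] by (auto simp: r_coset_def N_def)
    moreover have "card (N #> y) = q"
      using card_r_coset[OF Nc y] Nq by simp
    ultimately show ?thesis using card_subset_eq[OF Bf] q(2) by metis
  qed
  \<comment> \<open>The orbit of \<open>x\<close> under \<open>N\<close> has a size dividing
    \<open>q\<close>, while the class of \<open>x\<close> has only \<open>p < q\<close>
    elements.\<close>
  have Nx: "N \<subseteq> centralizer G x"
  proof -
    let ?O = "(\<lambda>g. conj_by G g x) ` N"
    have "card ?O * card (N \<inter> centralizer G x) = q"
      using card_orbit_subgroup[OF fin Ns x] Nq by simp
    moreover have "?O \<subseteq> ?A" using conjugacy_classI[OF x] Nc by auto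
    then have "card ?O \<le> p" using card_mono[OF Af] p(2) by metis
    ultimately have "card (N \<inter> centralizer G x) = q"
      using q(1) pq(1) by (metis dvd_triv_left leD mult_1 prime_nat_iff)
    moreover have "finite N" using finite_subset[OF Nc fin] .
    ultimately have "N \<inter> centralizer G x = N" using card_subset_eq[of N "N \<inter> centralizer G x"] Nq by simp
    then show ?thesis by blast
  qed
  \<comment> \<open>If \<open>g\<close> centralized \<open>N\<close> but moved \<open>x\<close>, its
    powers would move \<open>x\<close> through a whole coset of \<open>N\<close>, whose
    \<open>q\<close> elements do not fit into a class of size \<open>p\<close>.\<close>
  have CN: "g \<in> centralizer G x" if g: "g \<in> carrier G" "centralizes g N" for g
  proof (rule ccontr)
    assume ng: "g \<notin> centralizer G x"
    define d where "d = inv x \<otimes> conj_by G g x"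
    have dN: "d \<in> N" using comN g d_def by simp
    have dc: "d \<in> carrier G" using dN Nc by blast
    have gx: "conj_by G g x = x \<otimes> d" unfolding d_def using x g by (simp add: m_assoc[symmetric])
    have d1: "d \<noteq> \<one>" using gx g x ng conj_by_fixed_iff by auto
    have "(\<otimes>) x ` N \<subseteq> ?A"
    proof
      fix z assume "z \<in> (\<otimes>) x ` N"
      then obtain n where n: "n \<in> N" "z = x \<otimes> n" by blast
      obtain i :: nat where "n = d [^] i" using prime_order_powers[OF fin Ns Nq q(1) dN d1 n(1)] ..
      then have "z = conj_by G (g [^] i) x"
        using conj_by_pow_left_commuting[OF g(1) x dc gx] g dN n(2) by (simp add: centralizes_def)
      then show "z \<in> ?A" using conjugacy_classI x g by simp
    qed
    moreover have "card ((\<otimes>) x ` N) = q"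
      using x Nc Nq by (subst card_image) (auto intro!: inj_onI simp: subset_iff)
    ultimately show False using card_mono[OF Af] p(2) pq(1) by (metis leD)
  qed
  have NC: "centralizes g N" if g: "g \<in> carrier G" "g \<in> centralizer G x" for g
  proof -
    \<comment> \<open>Conjugations commute on \<open>N\<close>, so the commutator \<open>?k\<close>
      with an element \<open>h\<close> moving \<open>x\<close> acts trivially there, and by
      \<open>CN\<close> it fixes \<open>x\<close>. Unfolding this, \<open>g\<close> fixes
      \<open>conj_by G h x = x \<otimes> c\<close>; hence it fixes \<open>c\<close>, a generator of
      \<open>N\<close>.\<close>
    let ?k = "inv g \<otimes> (inv h \<otimes> (g \<otimes> h))"
    have kk: "conj_by G ?k z = conj_by G (inv g) (conj_by G (inv h) (conj_by G g (conj_by G h z)))"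
      if "z \<in> carrier G" for z using that g h by (simp add: conj_by_comp)
    have "centralizes ?k N"
      unfolding centralizes_def
    proof
      fix n assume n: "n \<in> N"
      then have nc: "n \<in> carrier G" using Nc by blast
      have "conj_by G ?k n = n"
        unfolding kk[OF nc] commutator_centralizes_prime_order[OF fin N Nq q(1) g(1) h(1) n]
        using g h nc by simp
      then show "?k \<in> centralizer G n" using conj_by_fixed_iff nc g h by simp
    qed
    then have "conj_by G ?k x = x" using CN[of ?k] conj_by_fixed x g h by simp
    then have "conj_by G (inv g) (conj_by G (inv h) (conj_by G g (conj_by G h x))) = x"
      using kk x by simp
    then have "conj_by G (inv h) (conj_by G g (conj_by G h x)) = conj_by G g x"
      using g h x by (metis conj_by_closed conj_by_inv_cancel(2) inv_closed)
    also have "\<dots> = x" using g x conj_by_fixed by simp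
    finally have "conj_by G g (conj_by G h x) = conj_by G h x"
      using g h x by (metis conj_by_closed conj_by_inv_cancel(2))
    then have "conj_by G g (x \<otimes> c) = x \<otimes> c" using hx by simp
    then have "x \<otimes> conj_by G g c = x \<otimes> c" using g x cc conj_by_fixed by (simp add: conj_by_mult)
    then have gc: "c \<in> centralizer G g" using g x cc conj_by_fixed_iff centralizer_sym by simp
    have "N \<subseteq> centralizer G g"
      using prime_order_subset[OF fin Ns Nq q(1) cN c1 centralizer_subgroup gc] g by blast
    then show ?thesis using Nc g centralizer_sym by (auto simp: centralizes_def)
  qed
  show ?thesis using that[OF N Nq comN By] CN NC by blast
qed

end

section \<open>Groups with class sizes 1 and p\<close>

lemma prime_power_decomposition:
  assumes "(n::nat) > 0" "Factorial_Ring.prime (p::nat)"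
  obtains m where "n = m * p ^ multiplicity p n" "\<not> p dvd m"
proof (rule multiplicity_decompose'[of n p])
  show "n \<noteq> 0" "\<not> is_unit p" using assms not_prime_unit by auto
qed (use that in \<open>auto simp: mult.commute\<close>)

context group
begin

section \<open>Products of subgroups, Sylow subgroups, and elements of order prime to p\<close>

lemma set_mult_commuting_subgroup:
  assumes H: "subgroup H G" and K: "subgroup K G"
    and comm: "\<And>h k. h \<in> H \<Longrightarrow> k \<in> K \<Longrightarrow> h \<otimes> k = k \<otimes> h"
  shows "subgroup (H <#> K) G"
proof (rule subgroupI)
  have c: "H \<subseteq> carrier G" "K \<subseteq> carrier G" using H K subgroup.subset by auto
  show "H <#> K \<subseteq> carrier G" using setmult_subset_G c by blast
  have "\<one> \<otimes> \<one> \<in> H <#> K" using H K subgroup.one_closed unfolding set_mult_def by blast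
  then show "H <#> K \<noteq> {}" by blast
  fix z assume "z \<in> H <#> K"
  then obtain h k where z: "h \<in> H" "k \<in> K" "z = h \<otimes> k" by (auto simp: set_mult_def)
  have zc: "h \<in> carrier G" "k \<in> carrier G" using z c by auto
  have "inv z = inv h \<otimes> inv k" using z(3) comm[OF z(1,2)] zc by (simp add: inv_mult_group)
  moreover have "inv h \<in> H" "inv k \<in> K" using z H K subgroup.m_inv_closed by metis+
  ultimately show "inv z \<in> H <#> K" unfolding set_mult_def by blast
  fix w assume "w \<in> H <#> K"
  then obtain h' k' where w: "h' \<in> H" "k' \<in> K" "w = h' \<otimes> k'" by (auto simp: set_mult_def)
  have wc: "h' \<in> carrier G" "k' \<in> carrier G" using w c by auto
  have "z \<otimes> w = h \<otimes> (k \<otimes> h') \<otimes> k'" using z w zc wc by (simp add: m_assoc)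
  also have "\<dots> = (h \<otimes> h') \<otimes> (k \<otimes> k')"
    unfolding comm[OF w(1) z(2), symmetric] using zc wc by (simp add: m_assoc)
  finally have "z \<otimes> w = (h \<otimes> h') \<otimes> (k \<otimes> k')" .
  moreover have "h \<otimes> h' \<in> H" "k \<otimes> k' \<in> K" using z w H K subgroup.m_closed by metis+
  ultimately show "z \<otimes> w \<in> H <#> K" unfolding set_mult_def by blast
qed

lemma normal_set_mult:
  assumes "N \<lhd> G" "subgroup S G" shows "subgroup (N <#> S) G"
  using second_isomorphism_grp.normal_set_mult_subgroup
  unfolding second_isomorphism_grp_def second_isomorphism_grp_axioms_def
  using assms by blast

lemma set_mult_incl:
  assumes "subgroup H G" "subgroup K G"
  shows "H \<subseteq> H <#> K" "K \<subseteq> H <#> K"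
proof -
  have c: "H \<subseteq> carrier G" "K \<subseteq> carrier G" using assms subgroup.subset by auto
  show "H \<subseteq> H <#> K"
  proof
    fix h assume "h \<in> H"
    then have "h \<otimes> \<one> = h" using c by auto
    moreover have "h \<otimes> \<one> \<in> H <#> K"
      using \<open>h \<in> H\<close> subgroup.one_closed[OF assms(2)] unfolding set_mult_def by blast
    ultimately show "h \<in> H <#> K" by simp
  qed
  show "K \<subseteq> H <#> K"
  proof
    fix k assume "k \<in> K"
    then have "\<one> \<otimes> k = k" using c by auto
    moreover have "\<one> \<otimes> k \<in> H <#> K"
      using \<open>k \<in> K\<close> subgroup.one_closed[OF assms(1)] unfolding set_mult_def by blast
    ultimately show "k \<in> H <#> K" by simp
  qed
qed

lemma set_mult_least:
  assumes "subgroup S G" "H \<subseteq> S" "K \<subseteq> S" shows "H <#> K \<subseteq> S"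
  using assms(2,3) by (auto simp: set_mult_def intro: subgroup.m_closed[OF assms(1)])

lemma sylow_in_subgroup:
  assumes fin: "finite (carrier G)" and S: "subgroup S G" and p: "Factorial_Ring.prime (p::nat)"
    and dvd: "p ^ a dvd card S"
  obtains T where "subgroup T G" "T \<subseteq> S" "card T = p ^ a"
proof -
  interpret S: group "G\<lparr>carrier := S\<rparr>" using subgroup.subgroup_is_group[OF S is_group] .
  obtain m where "card S = p ^ a * m" using dvd by blast
  then have "order (G\<lparr>carrier := S\<rparr>) = p ^ a * m" by (simp add: order_def)
  moreover have "finite (carrier (G\<lparr>carrier := S\<rparr>))"
    using finite_subset[OF subgroup.subset[OF S] fin] by simp
  ultimately obtain T where T: "subgroup T (G\<lparr>carrier := S\<rparr>)" "card T = p ^ a"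
    using sylow_thm[OF p S.is_group] by blast
  have "T \<subseteq> S" using subgroup.subset[OF T(1)] by simp
  then show ?thesis using that incl_subgroup[OF S T(1)] T(2) by blast
qed

lemma ord_dvd_card_subgroup:
  assumes "subgroup S G" "x \<in> S" shows "ord x dvd card S"
proof -
  have xc: "x \<in> carrier G" using assms subgroup.subset by blast
  have "generate G {x} \<subseteq> S" using generate_subgroup_incl[of "{x}" S] assms by blast
  then show ?thesis
    using card_subgroup_dvd[OF generate_is_subgroup assms(1)] generate_pow_card[OF xc] xc by auto
qed

lemma commuting_generate:
  assumes "x \<in> carrier G" "g \<in> centralizer G x" "y \<in> generate G {x}"
  shows "g \<otimes> y = y \<otimes> g"
proof -
  have gc: "g \<in> carrier G" using assms centralizer_carrier by blast
  have "generate G {x} \<subseteq> centralizer G g"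
    using generate_subgroup_incl[of "{x}"] centralizer_subgroup[OF gc] centralizer_sym gc assms by blast
  then show ?thesis using assms(3) by (auto simp: centralizer_def)
qed

text \<open>If \<open>x\<close> were a noncentral \<open>p'\<close>-element, choose a \<open>p\<close>-element \<open>g\<close> outside
  \<open>M = C(x)\<close>. Then \<open>M \<inter> C(g)\<close> has index \<open>p\<close> in \<open>M\<close>, since otherwise it contains a
  \<open>p\<close>-subgroup that together with \<open>g\<close> is too large for \<open>C(g)\<close>. But \<open>x\<close> is
  central in \<open>M\<close>, so the index of \<open>\<langle>x\<rangle> \<inter> C(g)\<close> in \<open>\<langle>x\<rangle>\<close> divides both \<open>p\<close> and
  the order of \<open>x\<close>.\<close>

lemma prime_class_sizes_imp_coprime_elements_central:
  assumes fin: "finite (carrier G)" and p: "Factorial_Ring.prime (p::nat)"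
    and cs: "\<And>x. x \<in> carrier G \<Longrightarrow> card (conjugacy_class G x) \<in> {1, p}"
    and x: "x \<in> carrier G" "\<not> p dvd ord x"
  shows "card (conjugacy_class G x) = 1"
proof (rule ccontr)
  assume nc: "card (conjugacy_class G x) \<noteq> 1"
  define n where "n = card (carrier G)"
  have npos: "n > 0" using subgroup_card_pos[OF fin subgroup_self] n_def by simp
  obtain m where m: "n = m * p ^ multiplicity p n" "\<not> p dvd m"
    using prime_power_decomposition npos p by blast
  let ?M = "centralizer G x"
  have M: "subgroup ?M G" using centralizer_subgroup x by blast
  have nM: "n = p * card ?M"
    using card_class_mult_centralizer[OF fin x(1)] cs[OF x(1)] nc by (simp add: n_def)
  then have "multiplicity p n \<noteq> 0" using p npos by (metis dvd_triv_left not_dvd_imp_multiplicity_0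
        multiplicity_eq_zero_iff not_gr_zero not_prime_unit prime_gt_0_nat)
  \<comment> \<open>\<open>Suc a\<close> is the exponent of \<open>p\<close> in the group order, so
    a subgroup of index \<open>p\<close> has no room for a subgroup of order
    \<open>p ^ Suc a\<close>.\<close>
  then obtain a where a: "multiplicity p n = Suc a" by (meson not0_implies_Suc)
  have Mm: "card ?M = p ^ a * m" using nM m(1) a prime_gt_0_nat[OF p] by (simp add: ac_simps)
  have big: "\<not> p ^ Suc a dvd p ^ a * m"
    using m(2) prime_gt_0_nat[OF p] by simp
  obtain Q where Q: "subgroup Q G" "card Q = p ^ Suc a"
    using sylow_in_subgroup[OF fin subgroup_self p, of "Suc a"] m(1) a n_def by (metis dvd_triv_right)
  have "\<not> Q \<subseteq> ?M" using card_subgroup_dvd[OF Q(1) M] Q(2) Mm big by auto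
  then obtain g where g: "g \<in> Q" "g \<notin> ?M" by blast
  have gc: "g \<in> carrier G" using g Q subgroup.subset by blast
  let ?C = "centralizer G g"
  have C: "subgroup ?C G" using centralizer_subgroup gc by blast
  have xC: "x \<notin> ?C" using g gc x centralizer_sym by blast
  then have "card (conjugacy_class G g) = p"
    using cs[OF gc] class_size_one_iff[OF fin gc] x by auto
  then have nC: "n = p * card ?C" using card_class_mult_centralizer[OF fin gc] n_def by simp
  then have CM: "card ?C = card ?M" using nM prime_gt_0_nat[OF p] by simp
  let ?I = "?M \<inter> ?C"
  have I: "subgroup ?I G" using subgroups_Inter_pair M C by blast
  have Ipos: "card ?I > 0" using subgroup_card_pos fin I by blast
  \<comment> \<open>\<open>j\<close> is the index of \<open>?I\<close> in \<open>?M\<close>. The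
    product formula bounds it by the index \<open>p\<close> of \<open>?C\<close> in the group, so it
    is equal to \<open>p\<close> once it is divisible by \<open>p\<close>.\<close>
  obtain j where j: "card ?M = card ?I * j" using card_subgroup_dvd[OF I M] by blast
  have "card (?M <#> ?C) * card ?I = j * card ?C * card ?I"
    using card_set_mult[OF fin M C] unfolding j by (simp only: ac_simps)
  then have "card (?M <#> ?C) = j * card ?C" using Ipos by simp
  moreover have "?M <#> ?C \<subseteq> carrier G"
    using setmult_subset_G subgroup.subset[OF M] subgroup.subset[OF C] by blast
  then have "card (?M <#> ?C) \<le> n" using card_mono[OF fin] n_def by simp
  ultimately have jp: "j \<le> p" using nC npos by simp
  have "p dvd j"
  proof (rule ccontr)
    assume "\<not> p dvd j"
    then have "coprime (p ^ a) j" using p prime_imp_coprime coprime_power_left_iff by blast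
    then have "p ^ a dvd card ?I" using j Mm by (metis coprime_dvd_mult_left_iff dvd_triv_left)
    then obtain T where T: "subgroup T G" "T \<subseteq> ?I" "card T = p ^ a"
      using sylow_in_subgroup[OF fin I p] by blast
    let ?U = "generate G {g}"
    have U: "subgroup ?U G" using generate_is_subgroup gc by blast
    have TU: "subgroup (T <#> ?U) G"
    proof (rule set_mult_commuting_subgroup[OF T(1) U])
      fix h k assume "h \<in> T" "k \<in> ?U"
      then show "h \<otimes> k = k \<otimes> h" using T(2) commuting_generate[OF gc] by blast
    qed
    have "?U \<subseteq> ?C" using generate_subgroup_incl[of "{g}"] C centralizer_self gc by blast
    then have "T <#> ?U \<subseteq> ?C" using set_mult_least[OF C] T(2) by blast
    then have dC: "card (T <#> ?U) dvd p ^ a * m" using card_subgroup_dvd[OF TU C] CM Mm by simp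
    have "card ?U dvd p ^ Suc a"
      using ord_dvd_card_subgroup[OF Q(1) g(1)] generate_pow_card[OF gc] Q(2) by simp
    then obtain k where k: "card ?U = p ^ k" using divides_primepow_nat[OF p] by blast
    have "card (T <#> ?U) dvd p ^ (a + k)"
      using card_set_mult[OF fin T(1) U] T(3) k by (metis dvd_triv_left power_add)
    then obtain b where b: "card (T <#> ?U) = p ^ b" using divides_primepow_nat[OF p] by blast
    have TsU: "T \<subseteq> T <#> ?U" "?U \<subseteq> T <#> ?U" using set_mult_incl T(1) U by auto
    \<comment> \<open>As \<open>g\<close> is outside \<open>?M\<close>, it is not in
      \<open>T\<close>. So the \<open>p\<close>-subgroup \<open>T <#> ?U\<close> of
      \<open>?C\<close> is properly larger than \<open>T\<close> and has order at least
      \<open>p ^ Suc a\<close>.\<close>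
    have "g \<in> T <#> ?U" using TsU generate.incl[of g "{g}"] by blast
    then have "T \<subset> T <#> ?U" using TsU T(2) g(2) by blast
    then have "card T < card (T <#> ?U)"
      using psubset_card_mono finite_subset[OF subgroup.subset[OF TU] fin] by blast
    then have "Suc a \<le> b" using T(3) b prime_gt_1_nat[OF p] by (simp add: power_strict_increasing_iff)
    then have "p ^ Suc a dvd p ^ a * m" using dC b le_imp_power_dvd dvd_trans by metis
    then show False using big by simp
  qed
  moreover have "j > 0" using j Mm subgroup_card_pos[OF fin M] by (cases j) auto
  ultimately have "j = p" using jp by (simp add: dvd_imp_le le_antisym)
  let ?X = "generate G {x}"
  have X: "subgroup ?X G" using generate_is_subgroup x by blast
  have XI: "subgroup (?X <#> ?I) G"
  proof (rule set_mult_commuting_subgroup[OF X I])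
    fix h k assume "h \<in> ?X" "k \<in> ?I"
    then show "h \<otimes> k = k \<otimes> h" using commuting_generate[OF x(1), of k h] by auto
  qed
  have "?X \<subseteq> ?M" using generate_subgroup_incl[of "{x}"] M centralizer_self x by blast
  then have "?X <#> ?I \<subseteq> ?M" using set_mult_least[OF M] by blast
  then have XM: "card (?X <#> ?I) dvd card ?I * p"
    using card_subgroup_dvd[OF XI M] j \<open>j = p\<close> by simp
  have XJ: "subgroup (?X \<inter> ?I) G" using subgroups_Inter_pair X I by blast
  obtain e where e: "card ?X = card (?X \<inter> ?I) * e"
    using card_subgroup_dvd[OF XJ X] by blast
  have "card (?X <#> ?I) * card (?X \<inter> ?I) = (card ?I * e) * card (?X \<inter> ?I)"
    using card_set_mult[OF fin X I] unfolding e by (simp only: ac_simps)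
  then have "card (?X <#> ?I) = card ?I * e" using subgroup_card_pos[OF fin XJ] by simp
  then have "e dvd p" using XM Ipos by simp
  moreover have "e dvd ord x" using e generate_pow_card[OF x(1)] by simp
  ultimately have "e = 1" using p x(2) by (metis prime_nat_iff)
  then have "?X \<inter> ?I = ?X"
    using e finite_subset[OF subgroup.subset[OF X] fin] card_subset_eq[of ?X "?X \<inter> ?I"] by simp
  then have "x \<in> ?C" using generate.incl[of x "{x}"] by blast
  then show False using xC by simp
qed

text \<open>Elements of order prime to \<open>p\<close> are central, so their products are again
  such elements and \<open>A\<close> is a subgroup. It contains every Sylow subgroup for a prime
  other than \<open>p\<close>; hence its order is a multiple of the p'-part of the group order, and
  a Sylow \<open>p\<close>-subgroup is a complement.\<close>

lemma prime_class_sizes_decomposition: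
  assumes fin: "finite (carrier G)" and p: "Factorial_Ring.prime (p::nat)"
    and cs: "\<And>x. x \<in> carrier G \<Longrightarrow> card (conjugacy_class G x) \<in> {1, p}"
  defines "A \<equiv> {x \<in> carrier G. \<not> p dvd ord x}"
  shows "\<exists>P a. subgroup P G \<and> card P = p ^ a \<and> subgroup A G \<and>
    (\<forall>z\<in>A. \<forall>g\<in>carrier G. z \<otimes> g = g \<otimes> z) \<and> P \<inter> A = {\<one>} \<and> P <#> A = carrier G"
proof -
  have Ac: "A \<subseteq> carrier G" by (auto simp: A_def)
  have comm: "z \<otimes> g = g \<otimes> z" if "z \<in> A" "g \<in> carrier G" for z g
  proof -
    have "card (conjugacy_class G z) = 1"
      using prime_class_sizes_imp_coprime_elements_central[OF fin p cs] that by (simp add: A_def)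
    then show ?thesis using class_size_one_iff[OF fin] that Ac by (auto simp: centralizer_def)
  qed
  have A: "subgroup A G"
  proof (rule subgroupI)
    show "A \<subseteq> carrier G" by (rule Ac)
    have "\<one> \<in> A" using p by (auto simp: A_def)
    then show "A \<noteq> {}" by blast
  next
    fix z assume "z \<in> A" then show "inv z \<in> A" by (simp add: A_def)
  next
    fix z w assume zw: "z \<in> A" "w \<in> A"
    then have c: "z \<in> carrier G" "w \<in> carrier G" using Ac by auto
    have "ord (z \<otimes> w) dvd ord z * ord w" using ord_mul_divides comm zw c by blast
    then show "z \<otimes> w \<in> A" using zw p c by (auto simp: A_def prime_dvd_mult_iff dest: dvd_trans)
  qed
  define n where "n = card (carrier G)"
  have npos: "n > 0" using subgroup_card_pos[OF fin subgroup_self] n_def by simp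
  obtain m where m: "n = m * p ^ multiplicity p n" "\<not> p dvd m"
    using prime_power_decomposition npos p by blast
  define a where "a = multiplicity p n"
  obtain P where P: "subgroup P G" "card P = p ^ a"
    using sylow_in_subgroup[OF fin subgroup_self p, of a] m(1) n_def a_def by (metis dvd_triv_right)
  have PA: "P \<inter> A = {\<one>}"
  proof
    show "P \<inter> A \<subseteq> {\<one>}"
    proof
      fix z assume z: "z \<in> P \<inter> A"
      then have "ord z dvd p ^ a" using ord_dvd_card_subgroup[OF P(1)] P(2) by auto
      then obtain k where "ord z = p ^ k" using divides_primepow_nat[OF p] by blast
      then have "ord z = 1" using z by (cases k) (auto simp: A_def)
      then show "z \<in> {\<one>}" using ord_eq_1 z Ac by auto
    qed
    show "{\<one>} \<subseteq> P \<inter> A" using P A subgroup.one_closed by auto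
  qed
  have Apos: "card A > 0" using subgroup_card_pos fin A by blast
  have "m dvd card A"
  proof (rule multiplicity_le_imp_dvd)
    show "m \<noteq> 0" using m(2) by (metis dvd_0_right)
    fix s :: nat assume s: "Factorial_Ring.prime s"
    show "multiplicity s m \<le> multiplicity s (card A)"
    proof (cases "s dvd m")
      case False
      then show ?thesis by (simp add: not_dvd_imp_multiplicity_0)
    next
      case True
      then have "s \<noteq> p" using m by auto
      have "s ^ multiplicity s m dvd n" using m(1) multiplicity_dvd dvd_mult2 by metis
      then obtain S where S: "subgroup S G" "card S = s ^ multiplicity s m"
        using sylow_in_subgroup[OF fin subgroup_self s] n_def by metis
      have "S \<subseteq> A"
      proof
        fix z assume z: "z \<in> S"
        then have "ord z dvd s ^ multiplicity s m" using ord_dvd_card_subgroup S by metis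
        then have "\<not> p dvd ord z" using p s \<open>s \<noteq> p\<close>
          by (metis dvd_trans prime_dvd_power primes_dvd_imp_eq)
        then show "z \<in> A" using z S subgroup.subset by (auto simp: A_def)
      qed
      then have "s ^ multiplicity s m dvd card A" using card_subgroup_dvd[OF S(1) A] S(2) by simp
      then show ?thesis using Apos s by (metis multiplicity_geI not_gr_zero not_prime_unit)
    qed
  qed
  then have "m * p ^ a dvd card A * card P" using P(2) by (simp add: mult_dvd_mono)
  then have "n dvd card P * card A" using m(1) a_def by (simp only: mult.commute)
  then have "n dvd card (P <#> A)" using card_set_mult[OF fin P(1) A] PA by simp
  moreover have sub: "P <#> A \<subseteq> carrier G" using setmult_subset_G subgroup.subset P A by blast
  moreover have "card (P <#> A) > 0" using set_mult_incl[OF P(1) A] subgroup.one_closed[OF A]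
    finite_subset[OF sub fin] by (auto simp: card_gt_0_iff)
  ultimately have "card (P <#> A) = card (carrier G)"
    using n_def card_mono[OF fin sub] by (simp add: dvd_imp_le le_antisym)
  then have "P <#> A = carrier G" using card_subset_eq[OF fin sub] by simp
  then show ?thesis using P A comm PA by blast
qed

text \<open>The centralizer of a noncentral \<open>x\<close> has index \<open>p\<close> in a
  \<open>p\<close>-group, so it is normal with a quotient of order \<open>p\<close>, which is
  abelian; therefore it contains all commutators.\<close>

lemma p_group_prime_class_sizes_commutators:
  assumes fin: "finite (carrier G)" and p: "Factorial_Ring.prime (p::nat)"
    and G: "card (carrier G) = p ^ k"
    and cs: "\<And>x. x \<in> carrier G \<Longrightarrow> card (conjugacy_class G x) \<in> {1, p}"
    and x: "x \<in> carrier G" and a: "a \<in> carrier G" and b: "b \<in> carrier G"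
  shows "conj_by G a b \<otimes> inv b \<in> centralizer G x"
proof (cases "card (conjugacy_class G x) = 1")
  case True
  then show ?thesis using class_size_one_iff[OF fin x] a b by simp
next
  case False
  then have xp: "card (conjugacy_class G x) = p" using cs x by blast
  let ?M = "centralizer G x"
  have M: "subgroup ?M G" using centralizer_subgroup x by blast
  have Mc: "?M \<subseteq> carrier G" using M subgroup.subset by blast
  \<comment> \<open>The orbit of another conjugate under \<open>?M\<close> misses \<open>x\<close>,
    so its size is a power of \<open>p\<close> less than \<open>p\<close>. Thus \<open>?M\<close>
    fixes every conjugate of \<open>x\<close>, which makes it normal.\<close>
  have fix_conj: "conj_by G m (conj_by G h x) = conj_by G h x" if h: "h \<in> carrier G" and m: "m \<in> ?M" for h m
  proof (cases "conj_by G h x = x")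
    case True
    then show ?thesis using m x conj_by_fixed by simp
  next
    case ne: False
    let ?z = "conj_by G h x"
    let ?O = "(\<lambda>g. conj_by G g ?z) ` ?M"
    have "?O \<subseteq> conjugacy_class G x"
      using conjugacy_class_closed[OF conjugacy_classI[OF x h] x] Mc by auto
    moreover have "x \<notin> ?O"
    proof
      assume "x \<in> ?O"
      then obtain m' where m': "x = conj_by G m' ?z" "m' \<in> ?M" by (rule imageE)
      have "conj_by G m' x = conj_by G m' ?z"
        unfolding conj_by_fixed[OF m'(2) x] by (rule m'(1))
      moreover have "m' \<in> carrier G" using m'(2) Mc by blast
      ultimately have "x = ?z" using h x by (intro iffD1[OF conj_by_eq_iff[of m' x ?z]]) auto
      then show False using ne by simp
    qed
    ultimately have "?O \<subset> conjugacy_class G x" using conjugacy_class_self[OF x] by blast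
    then have lt: "card ?O < p" using psubset_card_mono[OF finite_conjugacy_class[OF fin x]] xp by metis
    have "card ?O dvd card ?M" using card_orbit_subgroup[OF fin M, of ?z] x h by (metis conj_by_closed dvd_triv_left)
    then have "card ?O dvd p ^ k"
      using card_subgroup_dvd[OF M subgroup_self Mc] G by (metis dvd_trans)
    then obtain i where i: "card ?O = p ^ i" using divides_primepow_nat[OF p] by blast
    have "card ?O = 1"
    proof (cases i)
      case (Suc l)
      then have "p dvd card ?O" "card ?O > 0" using i prime_gt_0_nat[OF p] by auto
      then show ?thesis using lt dvd_imp_le by (metis not_less)
    qed (simp add: i)
    then obtain w where w: "?O = {w}" by (rule card_1_singletonE)
    have "conj_by G \<one> ?z \<in> ?O" using subgroup.one_closed[OF M] by blast
    moreover have "conj_by G m ?z \<in> ?O" using m by blast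
    ultimately show ?thesis using w h x by simp
  qed
  have N: "?M \<lhd> G"
  proof (rule normalI_conj_by[OF M])
    fix g m assume g: "g \<in> carrier G" and m: "m \<in> ?M"
    have mc: "m \<in> carrier G" using m Mc by blast
    have "conj_by G (conj_by G g m) x = conj_by G g (conj_by G m (conj_by G (inv g) x))"
      unfolding conj_by_def[of G g m] using g mc x by (simp add: conj_by_comp)
    also have "\<dots> = x" using fix_conj[OF _ m, of "inv g"] g x by simp
    finally show "conj_by G g m \<in> ?M" using conj_by_fixed_iff g mc x by simp
  qed
  show ?thesis
  proof (cases "b \<in> ?M")
    case True
    then show ?thesis using normal_conj_by[OF N True a] M
      by (simp add: subgroup.m_closed subgroup.m_inv_closed)
  next
    case bM: False
    \<comment> \<open>Now the group is \<open>?M <#> ?U\<close>. The part of \<open>a\<close> in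
      \<open>?U\<close> commutes with \<open>b\<close>, so \<open>a\<close> can be replaced by
      \<open>m\<close> in \<open>?M\<close>, and the commutator is \<open>m\<close> times a
      conjugate of \<open>inv m\<close>.\<close>
    let ?U = "generate G {b}"
    have U: "subgroup ?U G" using generate_is_subgroup b by blast
    have MU: "subgroup (?M <#> ?U) G"
      using normal_set_mult[OF N U] .
    have "b \<in> ?M <#> ?U" using set_mult_incl(2)[OF M U] generate.incl[of b "{b}"] by blast
    then have "?M \<noteq> ?M <#> ?U" using bM by blast
    then have "?M <#> ?U = carrier G"
      using subgroup_prime_index_maximal[OF fin M MU set_mult_incl(1)[OF M U] _ _ p]
        card_class_mult_centralizer[OF fin x] xp by metis
    then have "a \<in> ?M <#> ?U" using a by simp
    then obtain m u where mu: "m \<in> ?M" "u \<in> ?U" "a = m \<otimes> u" by (auto simp: set_mult_def)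
    have c: "m \<in> carrier G" "u \<in> carrier G" using mu Mc subgroup.subset[OF U] by auto
    have "b \<otimes> u = u \<otimes> b" using commuting_generate[OF b centralizer_self[OF b] mu(2)] .
    then have "u \<in> centralizer G b" using c by (simp add: centralizer_def)
    then have "conj_by G a b = conj_by G m b" using mu c b by (simp add: conj_by_comp conj_by_fixed)
    then have "conj_by G a b \<otimes> inv b = m \<otimes> conj_by G b (inv m)"
      using c b by (simp add: conj_by_def m_assoc)
    moreover have "conj_by G b (inv m) \<in> ?M" using normal_conj_by[OF N _ b] mu(1) M
      by (simp add: subgroup.m_inv_closed)
    ultimately show ?thesis using mu(1) M by (simp add: subgroup.m_closed)
  qed
qed

text \<open>Because the numbering starts at 0, the index 2 means the third term of the series. The
  hypothesis says that the commutators, hence the second term, are central.\<close>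

lemma lower_central_2_trivial:
  assumes comm: "\<And>x a b. x \<in> carrier G \<Longrightarrow> a \<in> carrier G \<Longrightarrow> b \<in> carrier G
    \<Longrightarrow> conj_by G a b \<otimes> inv b \<in> centralizer G x"
  shows "lower_central G 2 = {\<one>}"
proof -
  let ?L = "commutator_subgroup G (carrier G) (carrier G)"
  have cen: "?L \<subseteq> centralizer G x" if x: "x \<in> carrier G" for x
    unfolding commutator_subgroup_def
    by (rule generate_subgroup_incl[OF _ centralizer_subgroup[OF x]])
      (use comm[OF x] in \<open>auto simp: conj_by_def\<close>)
  let ?T = "{h \<otimes> k \<otimes> inv h \<otimes> inv k | h k. h \<in> ?L \<and> k \<in> carrier G}"
  have "?T \<subseteq> {\<one>}"
  proof
    fix z assume "z \<in> ?T"
    then obtain h k where hk: "h \<in> ?L" "k \<in> carrier G" "z = h \<otimes> k \<otimes> inv h \<otimes> inv k" by blast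
    have h: "h \<in> centralizer G k" using cen[OF hk(2)] hk(1) by blast
    then have "conj_by G h k = k" using conj_by_fixed hk(2) by blast
    then show "z \<in> {\<one>}" using hk by (simp add: conj_by_def)
  qed
  then have "generate G ?T \<subseteq> {\<one>}" using generate_subgroup_incl triv_subgroup by blast
  then have "generate G ?T = {\<one>}" using generate.one[of G ?T] by blast
  then have "lower_central G (Suc (Suc 0)) = {\<one>}"
    by (simp add: commutator_subgroup_def[of G ?L])
  then show ?thesis by (simp add: numeral_2_eq_2)
qed

end

section \<open>Normal subgroups of prime order and central products\<close>

context group
begin

lemma pow_coprime_in_subgroup:
  assumes S: "subgroup S G" and x: "x \<in> carrier G"
    and ab: "x [^] (a::nat) \<in> S" "x [^] (b::nat) \<in> S" "coprime a b"
  shows "x \<in> S"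
\<comment> \<open>For \<open>a = 0\<close> coprimality forces \<open>b = 1\<close>; the Bezout
  identity in the other case needs \<open>a\<close> nonzero.\<close>
proof (cases "a = 0")
  case True
  then show ?thesis using ab x by simp
next
  case False
  then obtain u v where uv: "a * u = b * v + 1"
    using bezout_nat[of a b] ab(3) by (auto simp: coprime_iff_gcd_eq_1)
  have s: "x [^] (a * u) \<in> S" "x [^] (b * v) \<in> S"
    using pow_in_subgroup[OF S] ab x by (auto simp: nat_pow_pow[symmetric])
  have "x [^] (a * u) = x [^] (b * v) \<otimes> x" using uv x by simp
  then have "x = inv (x [^] (b * v)) \<otimes> x [^] (a * u)"
    using x by (simp add: m_assoc[symmetric])
  then show ?thesis using s S by (metis subgroup.m_closed subgroup.m_inv_closed)
qed

lemma pow_index_in_normal: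
  assumes fin: "finite (carrier G)" and C: "C \<lhd> G" and q: "card (carrier G) = q * card C"
    and x: "x \<in> carrier G"
  shows "x [^] q \<in> C"
proof -
  interpret C: normal C G by (rule C)
  have Cs: "subgroup C G" using C normal_imp_subgroup by blast
  interpret Q: group "G Mod C" by (rule C.factorgroup_is_group)
  have "card (rcosets C) * card C = q * card C" using lagrange[OF Cs] q by (simp add: order_def)
  then have "order (G Mod C) = q"
    using subgroup_card_pos[OF fin Cs] by (simp add: order_def FactGroup_def)
  moreover have "C #> x \<in> carrier (G Mod C)" using x by (auto simp: carrier_FactGroup)
  ultimately have "(C #> x) [^]\<^bsub>G Mod C\<^esub> q = C" using Q.pow_order_eq_1 by fastforce
  then have "C #> (x [^] q) = C" using C.FactGroup_pow x by simp
  then show ?thesis using x Cs coset_join1 by (metis nat_pow_closed subgroup.subset)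
qed

lemma centralizes_subgroup_normal:
  assumes N: "N \<lhd> G"
  shows "{g \<in> carrier G. centralizes g N} \<lhd> G"
proof -
  have Ns: "subgroup N G" using N normal_imp_subgroup by blast
  have Nc: "N \<subseteq> carrier G" using Ns subgroup.subset by blast
  have fix_iff: "centralizes g N \<longleftrightarrow> (\<forall>n\<in>N. conj_by G g n = n)" if "g \<in> carrier G" for g
    unfolding centralizes_def using conj_by_fixed_iff that Nc by blast
  show ?thesis
  proof (rule normalI_conj_by)
    show "subgroup {g \<in> carrier G. centralizes g N} G"
    proof (rule subgroupI)
      have "centralizes \<one> N" unfolding centralizes_def
        using subgroup.one_closed[OF centralizer_subgroup] Nc by blast
      then show "{g \<in> carrier G. centralizes g N} \<noteq> {}" by blast
      fix a assume a: "a \<in> {g \<in> carrier G. centralizes g N}"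
      then show "inv a \<in> {g \<in> carrier G. centralizes g N}"
        unfolding centralizes_def using subgroup.m_inv_closed[OF centralizer_subgroup] Nc by blast
      fix b assume b: "b \<in> {g \<in> carrier G. centralizes g N}"
      show "a \<otimes> b \<in> {g \<in> carrier G. centralizes g N}"
        using a b unfolding centralizes_def
        using subgroup.m_closed[OF centralizer_subgroup] Nc by blast
    qed blast
    fix h g assume h: "h \<in> carrier G" and g: "g \<in> {g \<in> carrier G. centralizes g N}"
    then have gc: "g \<in> carrier G" and gN: "\<And>n. n \<in> N \<Longrightarrow> conj_by G g n = n" using fix_iff by auto
    have "conj_by G (conj_by G h g) n = n" if n: "n \<in> N" for n
    proof -
      have nc: "n \<in> carrier G" using n Nc by blast
      have "conj_by G (conj_by G h g) n = conj_by G h (conj_by G g (conj_by G (inv h) n))"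
        unfolding conj_by_def[of G h g] using h gc nc by (simp add: conj_by_comp)
      also have "\<dots> = n" using gN[OF normal_conj_by[OF N n, of "inv h"]] h nc by simp
      finally show ?thesis .
    qed
    then show "conj_by G h g \<in> {g \<in> carrier G. centralizes g N}" using fix_iff h gc by simp
  qed
qed

text \<open>Any nontrivial \<open>n\<close> generates \<open>N\<close>.\<close>

lemma prime_order_centralizes_iff:
  assumes fin: "finite (carrier G)" and N: "subgroup N G"
    and r: "card N = r" "Factorial_Ring.prime (r::nat)"
    and n: "n \<in> N" "n \<noteq> \<one>" and g: "g \<in> carrier G"
  shows "g \<in> centralizer G n \<longleftrightarrow> centralizes g N"
proof
  have Nc: "N \<subseteq> carrier G" using N subgroup.subset by blast
  assume "g \<in> centralizer G n"
  then have "n \<in> centralizer G g" using g n Nc centralizer_sym by blast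
  then have "N \<subseteq> centralizer G g"
    using prime_order_subset[OF fin N r n centralizer_subgroup[OF g]] by blast
  then show "centralizes g N" unfolding centralizes_def using g Nc centralizer_sym by blast
qed (use n in \<open>simp add: centralizes_def\<close>)

text \<open>An element acting nontrivially on \<open>N\<close> fixes only the identity there. So the
  subgroup \<open>N <#> centralizer G c\<close> is \<open>r\<close> times as large as the
  centralizer, and Lagrange's theorem gives the divisibility.\<close>

lemma card_prime_normal_mult_centralizer:
  assumes fin: "finite (carrier G)" and N: "N \<lhd> G"
    and r: "card N = r" "Factorial_Ring.prime (r::nat)"
    and c: "c \<in> carrier G" "\<not> centralizes c N"
  shows "N \<inter> centralizer G c = {\<one>}" "card (N <#> centralizer G c) = r * card (centralizer G c)"
    "r dvd card (conjugacy_class G c)"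
proof -
  have Ns: "subgroup N G" using N normal_imp_subgroup by blast
  have Nc: "N \<subseteq> carrier G" using Ns subgroup.subset by blast
  have C: "subgroup (centralizer G c) G" using centralizer_subgroup c by blast
  show int: "N \<inter> centralizer G c = {\<one>}"
  proof
    show "N \<inter> centralizer G c \<subseteq> {\<one>}"
    proof
      fix n assume n: "n \<in> N \<inter> centralizer G c"
      then have "c \<in> centralizer G n" using Nc c centralizer_sym by blast
      then show "n \<in> {\<one>}" using prime_order_centralizes_iff[OF fin Ns r _ _ c(1)] n c(2) by blast
    qed
    show "{\<one>} \<subseteq> N \<inter> centralizer G c" using Ns C subgroup.one_closed by blast
  qed
  show mult: "card (N <#> centralizer G c) = r * card (centralizer G c)"
    using card_set_mult[OF fin Ns C] int r by simp
  have sub: "subgroup (N <#> centralizer G c) G" using normal_set_mult[OF N C] .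
  have "card (N <#> centralizer G c) dvd card (carrier G)"
    using card_subgroup_dvd[OF sub subgroup_self subgroup.subset[OF sub]] .
  then have "r * card (centralizer G c) dvd card (conjugacy_class G c) * card (centralizer G c)"
    using mult card_class_mult_centralizer[OF fin c(1)] by simp
  then show "r dvd card (conjugacy_class G c)" using subgroup_card_pos[OF fin C] by simp
qed

text \<open>Otherwise \<open>c\<close> fixes an element \<open>y'\<close> of the coset, as it acts on it as an affine map
  with a nontrivial linear part. Then \<open>N C(c) \<le> C(y')\<close>, and the class size
  of \<open>c\<close> is divisible by the square of \<open>|N|\<close>.\<close>

lemma class_coset_not_centralizes:
  assumes fin: "finite (carrier G)" and N: "N \<lhd> G"
    and r: "card N = r" "Factorial_Ring.prime (r::nat)"
    and y: "y \<in> carrier G" "conjugacy_class G y = N #> y"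
    and c: "c \<in> carrier G" "\<not> centralizes c N"
    and sq: "\<not> r * r dvd card (conjugacy_class G c)"
  shows "\<not> centralizes y N"
proof
  assume yN: "centralizes y N"
  have Ns: "subgroup N G" using N normal_imp_subgroup by blast
  have Nc: "N \<subseteq> carrier G" using Ns subgroup.subset by blast
  have Nf: "finite N" using finite_subset[OF Nc fin] .
  note cN = card_prime_normal_mult_centralizer[OF fin N r c]
  have fix1: "n = \<one>" if n: "n \<in> N" "conj_by G c n = n" for n
    using cN(1) n Nc c conj_by_fixed_iff centralizer_sym by blast
  \<comment> \<open>\<open>?f\<close> measures how far \<open>n\<close> is from being fixed by
    \<open>c\<close>. It is injective because \<open>c\<close> fixes only the identity of
    \<open>N\<close>, hence it is onto \<open>N\<close>, so the shift \<open>n0\<close> of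
    \<open>y\<close> under \<open>c\<close> can be compensated by a suitable
    \<open>n\<close>.\<close>
  let ?f = "\<lambda>n. inv (conj_by G c n) \<otimes> n"
  have "?f ` N \<subseteq> N"
    using normal_conj_by[OF N _ c(1)] subgroup.m_inv_closed[OF Ns] subgroup.m_closed[OF Ns] by blast
  moreover have "inj_on ?f N"
  proof (rule inj_onI)
    fix n m assume nm: "n \<in> N" "m \<in> N" "?f n = ?f m"
    have nc: "n \<in> carrier G" "m \<in> carrier G" using nm Nc by auto
    let ?a = "conj_by G c n" and ?b = "conj_by G c m"
    have abc: "?a \<in> carrier G" "?b \<in> carrier G" using nc c by auto
    have "n = ?a \<otimes> (inv ?b \<otimes> m)" using nm(3) nc abc by (metis inv_closed inv_solve_left m_closed)
    then have "n = (?a \<otimes> inv ?b) \<otimes> m" using nc abc by (simp add: m_assoc del: conj_by_closed)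
    then have "n \<otimes> inv m = ?a \<otimes> inv ?b"
      by (intro iffD2[OF inv_solve_right']) (use nc abc in auto)
    moreover have "conj_by G c (n \<otimes> inv m) = ?a \<otimes> inv ?b"
      using nc c by (simp add: conj_by_mult conj_by_inv)
    moreover have "n \<otimes> inv m \<in> N" using nm Ns by (simp add: subgroup.m_closed subgroup.m_inv_closed)
    ultimately have "n \<otimes> inv m = \<one>" using fix1[of "n \<otimes> inv m"] by simp
    then show "n = m" using nc by (metis inv_closed inv_inv inv_equality)
  qed
  ultimately have surj: "?f ` N = N" using endo_inj_surj[OF Nf] by blast
  have "conj_by G c y \<in> N #> y" using conjugacy_classI[OF y(1) c(1)] y(2) by simp
  then obtain n0 where n0: "n0 \<in> N" "conj_by G c y = n0 \<otimes> y" by (auto simp: r_coset_def)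
  have "n0 \<in> ?f ` N" using surj n0 by simp
  then obtain n where n: "n0 = ?f n" "n \<in> N" by (rule imageE)
  have nc: "n \<in> carrier G" using n Nc by blast
  define y' where "y' = n \<otimes> y"
  have y'c: "y' \<in> carrier G" using nc y y'_def by simp
  have "conj_by G c y' = conj_by G c n \<otimes> (inv (conj_by G c n) \<otimes> n \<otimes> y)"
    using n0 n(1) nc y c by (simp add: y'_def conj_by_mult)
  also have "\<dots> = y'" using nc y c by (simp add: y'_def m_assoc[symmetric])
  finally have cy': "conj_by G c y' = y'" .
  have "y' \<in> N #> y" using n y'_def by (auto simp: r_coset_def)
  then have y'B: "y' \<in> conjugacy_class G y" using y(2) by simp
  then obtain h where h: "h \<in> carrier G" "y' = conj_by G h y" using y(1) by (rule conjugacy_classE)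
  have By': "N #> y = N #> y'" using repr_independence[OF \<open>y' \<in> N #> y\<close> y(1) Ns] .
  \<comment> \<open>\<open>y'\<close> is conjugate to \<open>y\<close>, and C_G(N) is
    normal.\<close>
  have "y' \<in> {g \<in> carrier G. centralizes g N}"
    using normal_conj_by[OF centralizes_subgroup_normal[OF N], of y h] yN y(1) h by simp
  then have "N \<subseteq> centralizer G y'"
    using Nc y'c centralizer_sym unfolding centralizes_def by blast
  \<comment> \<open>An element \<open>g\<close> commuting with \<open>c\<close> moves
    \<open>y'\<close> by some \<open>n1\<close> in \<open>N\<close>. Since \<open>c\<close> fixes
    \<open>y'\<close> and commutes with \<open>g\<close>, it fixes \<open>n1\<close>, which is
    therefore trivial.\<close>
  moreover have "centralizer G c \<subseteq> centralizer G y'"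
  proof
    fix g assume g: "g \<in> centralizer G c"
    have gc: "g \<in> carrier G" using g centralizer_carrier by blast
    have comm: "c \<otimes> g = g \<otimes> c" using g by (simp add: centralizer_def)
    have "conj_by G g y' \<in> N #> y'"
      using conjugacy_class_closed[OF y'B y(1) gc] y(2) By' by simp
    then obtain n1 where n1: "n1 \<in> N" "conj_by G g y' = n1 \<otimes> y'" by (auto simp: r_coset_def)
    have n1c: "n1 \<in> carrier G" using n1 Nc by blast
    have "conj_by G c (conj_by G g y') = conj_by G g (conj_by G c y')"
      using comm c gc y'c by (simp add: conj_by_comp[symmetric])
    then have "conj_by G c n1 \<otimes> y' = n1 \<otimes> y'"
      using n1 n1c cy' c y'c by (simp add: conj_by_mult)
    then have "conj_by G c n1 = n1" using n1c c y'c by simp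
    then have "n1 = \<one>" using fix1 n1 by blast
    then show "g \<in> centralizer G y'" using n1(2) y'c gc conj_by_fixed_iff by simp
  qed
  ultimately have sub: "N <#> centralizer G c \<subseteq> centralizer G y'"
    using set_mult_least[OF centralizer_subgroup[OF y'c]] by blast
  have C: "subgroup (centralizer G c) G" using centralizer_subgroup c by blast
  obtain t where t: "card (centralizer G y') = r * card (centralizer G c) * t"
    using card_subgroup_dvd[OF normal_set_mult[OF N C] centralizer_subgroup[OF y'c] sub] cN(2)
    by auto
  have "conjugacy_class G y' \<subseteq> conjugacy_class G y"
    using conjugacy_class_closed[OF y'B y(1)] y'c by (auto simp: conjugacy_class_eq)
  have "card (conjugacy_class G y') = r"
  proof -
    have "conjugacy_class G y' = conjugacy_class G y"
    proof
      show "conjugacy_class G y \<subseteq> conjugacy_class G y'"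
      proof
        fix z assume "z \<in> conjugacy_class G y"
        then obtain g where g: "g \<in> carrier G" "z = conj_by G g y" using y(1) by (rule conjugacy_classE)
        then have "z = conj_by G (g \<otimes> inv h) y'" using h y by (simp add: conj_by_comp)
        then show "z \<in> conjugacy_class G y'" using conjugacy_classI y'c g h by simp
      qed
    qed fact
    then show ?thesis using y card_r_coset[OF Nc y(1)] r by simp
  qed
  \<comment> \<open>One factor \<open>r\<close> is the class size of \<open>y'\<close>, the other
    comes from the index of the centralizer of \<open>c\<close> in that of
    \<open>y'\<close>.\<close>
  then have "card (conjugacy_class G c) * card (centralizer G c) = r * r * t * card (centralizer G c)"
    using card_class_mult_centralizer[OF fin c(1)] card_class_mult_centralizer[OF fin y'c] t
    by (simp add: ac_simps)
  then have "card (conjugacy_class G c) = r * r * t" using subgroup_card_pos[OF fin C] by simp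
  then show False using sq by simp
qed

section \<open>Conjugacy classes in subgroups and in central products\<close>

lemma conj_by_subgroup_carrier:
  assumes "subgroup S G" "g \<in> S"
  shows "conj_by (G\<lparr>carrier := S\<rparr>) g x = conj_by G g x"
  using m_inv_consistent[OF assms] by (simp add: conj_by_def)

lemma conjugacy_class_subgroup:
  assumes S: "subgroup S G" and x: "x \<in> S"
  shows "conjugacy_class (G\<lparr>carrier := S\<rparr>) x = (\<lambda>g. conj_by G g x) ` S"
proof -
  have "conjugacy_class (G\<lparr>carrier := S\<rparr>) x = (\<lambda>g. conj_by (G\<lparr>carrier := S\<rparr>) g x) ` S"
    using conjugacy_class_eq[of x "G\<lparr>carrier := S\<rparr>"] x by simp
  also have "\<dots> = (\<lambda>g. conj_by G g x) ` S" using conj_by_subgroup_carrier[OF S] by simp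
  finally show ?thesis .
qed

context
  fixes K L
  assumes K: "subgroup K G" and L: "subgroup L G"
    and comm: "\<And>k l. k \<in> K \<Longrightarrow> l \<in> L \<Longrightarrow> k \<otimes> l = l \<otimes> k"
    and KL: "K <#> L = carrier G"
begin

lemma central_product_conj_by:
  assumes "k \<in> K" "l \<in> L" "a \<in> K" "b \<in> L"
  shows "conj_by G (k \<otimes> l) (a \<otimes> b) = conj_by G k a \<otimes> conj_by G l b"
proof -
  have c: "k \<in> carrier G" "l \<in> carrier G" "a \<in> carrier G" "b \<in> carrier G"
    using assms subgroup.subset[OF K] subgroup.subset[OF L] by auto
  have "conj_by G l a = a" using comm[OF assms(3,2)] c by (intro conj_by_fixed) (auto simp: centralizer_def)
  moreover have "conj_by G k (conj_by G l b) = conj_by G l b"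
  proof (rule conj_by_fixed)
    have "conj_by G l b \<in> L" using assms L unfolding conj_by_def
      by (simp add: subgroup.m_closed subgroup.m_inv_closed)
    then show "k \<in> centralizer G (conj_by G l b)" using comm assms c by (simp add: centralizer_def)
  qed (use c in simp)
  ultimately show ?thesis using c by (simp add: conj_by_comp conj_by_mult)
qed

text \<open>Conjugation by \<open>L\<close> is trivial on \<open>K\<close>. This allows the class
  sizes of a factor, taken as a group of its own, to be read off in the whole group.\<close>

lemma central_product_class_left:
  assumes a: "a \<in> K"
  shows "conjugacy_class (G\<lparr>carrier := K\<rparr>) a = conjugacy_class G a"
proof -
  have ac: "a \<in> carrier G" using a subgroup.subset[OF K] by blast
  have "conj_by G g a \<in> (\<lambda>g. conj_by G g a) ` K" if "g \<in> carrier G" for g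
  proof -
    have "g \<in> K <#> L" using that KL by simp
    then obtain k l where kl: "k \<in> K" "l \<in> L" "g = k \<otimes> l" by (auto simp: set_mult_def)
    have "conj_by G (k \<otimes> l) (a \<otimes> \<one>) = conj_by G k a \<otimes> conj_by G l \<one>"
      using central_product_conj_by[OF kl(1,2) a subgroup.one_closed[OF L]] .
    then have "conj_by G g a = conj_by G k a"
      using kl ac subgroup.subset[OF K] subgroup.subset[OF L] by (simp add: subset_iff)
    then show ?thesis using kl by blast
  qed
  then show ?thesis unfolding conjugacy_class_subgroup[OF K a] conjugacy_class_eq[OF ac]
    using subgroup.subset[OF K] by blast
qed

text \<open>The factors conjugate independently, so the class of \<open>a \<otimes> b\<close>
  consists of all products of the two classes. Injectivity is asked for only between
  \<open>K\<close> and the class of \<open>b\<close> because the factors may overlap, as the later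
  \<open>K\<close> and \<open>L\<close> do in \<open>y [^] q\<close>.\<close>

lemma central_product_class_size:
  assumes a: "a \<in> K" and b: "b \<in> L"
    and inj: "\<And>a1 a2 b1 b2. \<lbrakk>a1 \<in> K; a2 \<in> K; b1 \<in> conjugacy_class G b; b2 \<in> conjugacy_class G b;
      a1 \<otimes> b1 = a2 \<otimes> b2\<rbrakk> \<Longrightarrow> a1 = a2"
  shows "card (conjugacy_class G (a \<otimes> b)) = card (conjugacy_class G a) * card (conjugacy_class G b)"
proof -
  have Kc: "K \<subseteq> carrier G" and Lc: "L \<subseteq> carrier G" using K L subgroup.subset by auto
  have c: "a \<in> carrier G" "b \<in> carrier G" using a b Kc Lc by auto
  have "conjugacy_class G a = (\<lambda>g. conj_by G g a) ` K"
    using central_product_class_left[OF a] conjugacy_class_subgroup[OF K a] by simp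
  then have clK: "conjugacy_class G a \<subseteq> K"
    using a K by (auto simp: conj_by_def subgroup.m_closed subgroup.m_inv_closed)
  have b2: "conj_by G (k \<otimes> l) b = conj_by G l b" and a2: "conj_by G (k \<otimes> l) a = conj_by G k a"
    if "k \<in> K" "l \<in> L" for k l
    using central_product_conj_by[OF that subgroup.one_closed[OF K] b]
      central_product_conj_by[OF that a subgroup.one_closed[OF L]] c that Kc Lc
    by (auto simp: subset_iff)
  let ?f = "\<lambda>(a, b). a \<otimes> b"
  have "conjugacy_class G (a \<otimes> b) = ?f ` (conjugacy_class G a \<times> conjugacy_class G b)"
  proof
    show "conjugacy_class G (a \<otimes> b) \<subseteq> ?f ` (conjugacy_class G a \<times> conjugacy_class G b)"
    proof
      fix z assume "z \<in> conjugacy_class G (a \<otimes> b)"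
      then obtain g where g: "g \<in> carrier G" "z = conj_by G g (a \<otimes> b)"
        using c by (auto elim: conjugacy_classE)
      then have "z = ?f (conj_by G g a, conj_by G g b)" using c by (simp add: conj_by_mult)
      moreover have "(conj_by G g a, conj_by G g b) \<in> conjugacy_class G a \<times> conjugacy_class G b"
        using conjugacy_classI c g by simp
      ultimately show "z \<in> ?f ` (conjugacy_class G a \<times> conjugacy_class G b)" by blast
    qed
    show "?f ` (conjugacy_class G a \<times> conjugacy_class G b) \<subseteq> conjugacy_class G (a \<otimes> b)"
    proof
      fix z assume "z \<in> ?f ` (conjugacy_class G a \<times> conjugacy_class G b)"
      then obtain a' b' where ab': "a' \<in> conjugacy_class G a" "b' \<in> conjugacy_class G b" "z = a' \<otimes> b'"
        by auto
      obtain g where g: "g \<in> carrier G" "a' = conj_by G g a" using ab'(1) c(1) by (rule conjugacy_classE)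
      obtain h where h: "h \<in> carrier G" "b' = conj_by G h b" using ab'(2) c(2) by (rule conjugacy_classE)
      have "g \<in> K <#> L" "h \<in> K <#> L" using g h KL by auto
      then obtain k l k' l' where kl: "k \<in> K" "l \<in> L" "g = k \<otimes> l" "k' \<in> K" "l' \<in> L" "h = k' \<otimes> l'"
        unfolding set_mult_def by blast
      have "z = conj_by G k a \<otimes> conj_by G l' b" using ab' g h kl a2 b2 by simp
      also have "\<dots> = conj_by G (k \<otimes> l') (a \<otimes> b)"
        using central_product_conj_by[OF kl(1,5) a b] by simp
      finally have "z = conj_by G (k \<otimes> l') (a \<otimes> b)" .
      moreover have "k \<otimes> l' \<in> carrier G" using kl Kc Lc by blast
      ultimately show "z \<in> conjugacy_class G (a \<otimes> b)" using conjugacy_classI c by simp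
    qed
  qed
  moreover have "inj_on ?f (conjugacy_class G a \<times> conjugacy_class G b)"
  proof (rule inj_onI)
    fix u v assume uv: "u \<in> conjugacy_class G a \<times> conjugacy_class G b"
      "v \<in> conjugacy_class G a \<times> conjugacy_class G b" "?f u = ?f v"
    obtain a1 b1 a2 b2 where e: "u = (a1, b1)" "v = (a2, b2)" by (cases u, cases v)
    have "a1 = a2" using uv e clK inj[of a1 a2 b1 b2] by auto
    moreover have "b1 \<in> carrier G" "b2 \<in> carrier G" "a1 \<in> carrier G"
      using uv e conjugacy_class_carrier c by auto
    ultimately show "u = v" using uv(3) e by simp
  qed
  ultimately show ?thesis by (simp add: card_image card_cartesian_product)
qed

end

end

section \<open>Frobenius groups\<close>

context group
begin

text \<open>As the index is prime and \<open>C\<close> is not normal, \<open>C\<close> is its own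
  normalizer \<open>?S\<close>. As its order is prime, a conjugate meeting it nontrivially coincides
  with it.\<close>

lemma frobenius_groupI_prime:
  assumes fin: "finite (carrier G)" and C: "subgroup C G"
    and q: "card C = q" "Factorial_Ring.prime (q::nat)"
    and r: "card (carrier G) = r * card C" "Factorial_Ring.prime (r::nat)"
    and nn: "\<not> C \<lhd> G"
  shows "frobenius_group G"
proof -
  have Cc: "C \<subseteq> carrier G" using C subgroup.subset by blast
  have Cf: "finite C" using finite_subset[OF Cc fin] .
  let ?S = "{g \<in> carrier G. conj_by G g ` C = C}"
  have S: "subgroup ?S G"
  proof (rule subgroupI)
    have "conj_by G \<one> ` C = (\<lambda>x. x) ` C" by (rule image_cong) (use Cc in auto)
    then have "\<one> \<in> ?S" by simp
    then show "?S \<noteq> {}" by blast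
    fix a assume a: "a \<in> ?S"
    have "conj_by G (inv a) ` C = conj_by G (inv a) ` conj_by G a ` C" using a by simp
    also have "\<dots> = (\<lambda>x. x) ` C" unfolding image_image by (rule image_cong) (use a Cc in auto)
    finally show "inv a \<in> ?S" using a by simp
    fix b assume b: "b \<in> ?S"
    have "conj_by G (a \<otimes> b) ` C = conj_by G a ` conj_by G b ` C"
      unfolding image_image by (rule image_cong) (use a b Cc in \<open>auto simp: conj_by_comp\<close>)
    then show "a \<otimes> b \<in> ?S" using a b by simp
  qed blast
  have stab: "g \<in> ?S" if g: "g \<in> carrier G" "\<And>c. c \<in> C \<Longrightarrow> conj_by G g c \<in> C" for g
  proof -
    have "inj_on (conj_by G g) C" by (rule inj_onI) (metis conj_by_eq_iff g(1) Cc subsetD)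
    then have "conj_by G g ` C = C" using endo_inj_surj[OF Cf] g(2) by blast
    then show ?thesis using g by simp
  qed
  have "C \<subseteq> ?S"
  proof
    fix g assume g: "g \<in> C"
    show "g \<in> ?S" using g C Cc
      by (intro stab) (auto simp: conj_by_def subgroup.m_closed subgroup.m_inv_closed)
  qed
  moreover have "?S \<noteq> carrier G"
  proof
    assume e: "?S = carrier G"
    have "C \<lhd> G"
    proof (rule normalI_conj_by[OF C])
      fix g n assume "g \<in> carrier G" "n \<in> C"
      then show "conj_by G g n \<in> C" using e by blast
    qed
    then show False using nn by simp
  qed
  ultimately have SC: "?S = C" using subgroup_prime_index_maximal[OF fin C S _ _ r] by blast
  have cos: "g <# C #> inv g = conj_by G g ` C" for g
    by (auto simp: l_coset_def r_coset_def conj_by_def)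
  have "C \<inter> (g <# C #> inv g) = {\<one>}" if g: "g \<in> carrier G - C" for g
  proof
    show "C \<inter> (g <# C #> inv g) \<subseteq> {\<one>}"
    proof (rule ccontr)
      assume "\<not> C \<inter> (g <# C #> inv g) \<subseteq> {\<one>}"
      then obtain z where z: "z \<in> C" "z \<in> conj_by G g ` C" "z \<noteq> \<one>" unfolding cos by blast
      obtain c where c: "z = conj_by G g c" "c \<in> C" using z(2) by (rule imageE)
      have c1: "c \<noteq> \<one>" using c z g by auto
      have "conj_by G g d \<in> C" if d: "d \<in> C" for d
      proof -
        obtain i :: nat where "d = c [^] i" using prime_order_powers[OF fin C q c(2) c1 d] ..
        then have "conj_by G g d = z [^] i" using c g Cc by (auto simp: conj_by_pow)
        then show ?thesis using pow_in_subgroup[OF C z(1)] by simp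
      qed
      then have "g \<in> ?S" using stab g by blast
      then show False using SC g by blast
    qed
    have "conj_by G g \<one> \<in> conj_by G g ` C" using subgroup.one_closed[OF C] by blast
    moreover have "conj_by G g \<one> = \<one>" using g by simp
    ultimately show "{\<one>} \<subseteq> C \<inter> (g <# C #> inv g)"
      unfolding cos using subgroup.one_closed[OF C] by simp
  qed
  moreover have "C \<noteq> {\<one>}" using q prime_gt_1_nat by auto
  moreover have "C \<noteq> carrier G" using nn normal_self by blast
  ultimately show ?thesis unfolding frobenius_group_def using C is_group by blast
qed

lemma center_eq: "center G = carrier G \<inter> (\<Inter>x\<in>carrier G. centralizer G x)"
  by (auto simp: center_def centralizer_def)

lemma center_centralizer:
  assumes "z \<in> center G" "x \<in> carrier G"
  shows "z \<in> centralizer G x" "x \<in> centralizer G z"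
proof -
  have e: "z \<otimes> x = x \<otimes> z" using assms unfolding center_def by blast
  then show "z \<in> centralizer G x" using assms unfolding centralizer_def center_def by blast
  show "x \<in> centralizer G z" using e[symmetric] assms unfolding centralizer_def by blast
qed

lemma center_normal: "center G \<lhd> G"
proof (rule normalI_conj_by)
  show "subgroup (center G) G"
  proof (rule subgroupI)
    show "center G \<noteq> {}" using subgroup.one_closed[OF centralizer_subgroup] by (auto simp: center_eq)
  qed (auto simp: center_eq subgroup.m_closed[OF centralizer_subgroup]
      subgroup.m_inv_closed[OF centralizer_subgroup])
  fix g n assume g: "g \<in> carrier G" and n: "n \<in> center G"
  then have "conj_by G g n = n" 
    using center_centralizer(2) conj_by_fixed unfolding center_def by blast
  then show "conj_by G g n \<in> center G" using n by simp
qed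

text \<open>The complement is the image of the group generated by \<open>y\<close>. It has order
  \<open>q\<close>, since \<open>y\<close> is not central but its \<open>q\<close>-th power
  is.\<close>

lemma frobenius_mod_center:
  assumes fin: "finite (carrier G)" and N: "N \<lhd> G"
    and r: "card N = r" "Factorial_Ring.prime (r::nat)"
    and y: "y \<in> carrier G" "N \<inter> centralizer G y = {\<one>}"
    and q: "Factorial_Ring.prime (q::nat)" "y [^] q \<in> center G" "q \<noteq> r"
    and order: "card (carrier G) = q * r * card (center G)"
  shows "frobenius_group (G Mod center G)" "order (G Mod center G) = q * r"
proof -
  let ?Z = "center G"
  let ?Q = "G Mod center G"
  let ?\<pi> = "\<lambda>a. center G #> a"
  interpret Z: normal "center G" G by (rule center_normal)
  have Zs: "subgroup ?Z G" using center_normal normal_imp_subgroup by blast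
  interpret Q: group ?Q by (rule Z.factorgroup_is_group)
  interpret pi: group_hom G ?Q ?\<pi>
    using Z.r_coset_hom_Mod is_group Q.is_group by (simp add: group_hom_def group_hom_axioms_def)
  have Ns: "subgroup N G" using N normal_imp_subgroup by blast
  have Nc: "N \<subseteq> carrier G" using Ns subgroup.subset by blast
  have "card (rcosets ?Z) * card ?Z = q * r * card ?Z"
    using lagrange[OF Zs] order by (simp add: order_def)
  then have cQ: "card (carrier ?Q) = q * r"
    using subgroup_card_pos[OF fin Zs] by (simp add: FactGroup_def)
  then show "order ?Q = q * r" by (simp add: order_def)
  have finQ: "finite (carrier ?Q)" using fin by (simp add: carrier_FactGroup)
  have pi1: "?\<pi> a = \<one>\<^bsub>?Q\<^esub> \<longleftrightarrow> a \<in> ?Z" if "a \<in> carrier G" for a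
    using that coset_join1[OF _ that Zs] coset_join2[OF that Zs] by auto
  have "card N \<noteq> 1" using r by auto
  then have "N \<noteq> {\<one>}" by auto
  then obtain n where n: "n \<in> N" "n \<noteq> \<one>"
    using subgroup.one_closed[OF Ns] by blast
  have nc: "n \<in> carrier G" using n Nc by blast
  have ny: "n \<notin> centralizer G y" using y(2) n by blast
  have "n \<in> centralizer G y" if "y \<in> ?Z"
    using center_centralizer(2)[OF that nc] .
  then have "y \<notin> ?Z" using ny by blast
  then have "Q.ord (?\<pi> y) \<noteq> 1" using pi1[OF y(1)] Q.ord_eq_1 y(1) by simp
  moreover have "?\<pi> y [^]\<^bsub>?Q\<^esub> q = \<one>\<^bsub>?Q\<^esub>"
    using Z.FactGroup_pow[OF y(1)] pi1[of "y [^] q"] q(2) y(1) by simp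
  then have "Q.ord (?\<pi> y) dvd q" using Q.pow_eq_id y(1) by simp
  ultimately have ordy: "Q.ord (?\<pi> y) = q" using q(1) by (auto simp: prime_nat_iff)
  let ?C = "generate ?Q {?\<pi> y}"
  have C: "subgroup ?C ?Q" using Q.generate_is_subgroup y(1) by simp
  have cC: "card ?C = q" using ordy Q.generate_pow_card y(1) by simp
  have yC: "?\<pi> y \<in> ?C" by (simp add: generate.incl)
  have "\<not> ?C \<lhd> ?Q"
  proof
    assume norm: "?C \<lhd> ?Q"
    \<comment> \<open>If the complement were normal, the order of the image of \<open>?m\<close>
      would divide \<open>q\<close>, and it divides \<open>r\<close> because \<open>?m\<close> lies
      in \<open>N\<close>. So \<open>?m\<close> is central and lies in
      \<open>N \<inter> centralizer G y\<close>, which makes \<open>n\<close> commute with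
      \<open>y\<close>.\<close>
    let ?m = "conj_by G n y \<otimes> inv y"
    have "?m = n \<otimes> conj_by G y (inv n)" using nc y(1) by (simp add: conj_by_def m_assoc)
    moreover have "conj_by G y (inv n) \<in> N"
      using normal_conj_by[OF N subgroup.m_inv_closed[OF Ns n(1)] y(1)] .
    ultimately have mN: "?m \<in> N" using n(1) Ns by (simp add: subgroup.m_closed)
    have mc: "?m \<in> carrier G" using nc y(1) by simp
    have "?\<pi> ?m = conj_by ?Q (?\<pi> n) (?\<pi> y) \<otimes>\<^bsub>?Q\<^esub> inv\<^bsub>?Q\<^esub> (?\<pi> y)"
      using nc y(1) pi.hom_mult pi.hom_inv by (simp add: conj_by_def del: mult_FactGroup)
    also have "\<dots> \<in> ?C"
      using Q.normal_conj_by[OF norm yC] subgroup.m_closed[OF C] subgroup.m_inv_closed[OF C yC] nc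
      by (simp del: mult_FactGroup)
    finally have "Q.ord (?\<pi> ?m) dvd q" using Q.ord_dvd_card_subgroup[OF C] cC by simp
    then have a: "?\<pi> ?m [^]\<^bsub>?Q\<^esub> q = \<one>\<^bsub>?Q\<^esub>" using Q.pow_eq_id mc by simp
    have "ord ?m dvd r" using ord_dvd_card_subgroup[OF Ns mN] r(1) by simp
    then have "?m [^] r = \<one>" using pow_eq_id mc by simp
    then have b: "?\<pi> ?m [^]\<^bsub>?Q\<^esub> r = \<one>\<^bsub>?Q\<^esub>"
      using Z.FactGroup_pow[OF mc] pi1[of \<one>] Zs subgroup.one_closed by simp
    have "coprime q r" using q r primes_coprime by blast
    then have "?\<pi> ?m \<in> {\<one>\<^bsub>?Q\<^esub>}"
      using Q.pow_coprime_in_subgroup[OF Q.triv_subgroup _ _ _] a b mc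
      by (metis pi.hom_closed singletonI)
    then have "?m \<in> ?Z" using pi1[OF mc] by simp
    then have "?m \<in> centralizer G y" using center_centralizer(1) y(1) by blast
    then have "?m = \<one>" using mN y(2) by blast
    then have "conj_by G n y = y" using nc y(1)
      by (metis conj_by_closed inv_closed inv_inv inv_equality)
    then show False using ny conj_by_fixed_iff nc y(1) by blast
  qed
  moreover have "card (carrier ?Q) = r * card ?C" using cQ cC by simp
  ultimately show "frobenius_group ?Q"
    using Q.frobenius_groupI_prime[OF finQ C cC q(1) _ r(2)] by blast
qed

end

section \<open>An element acting on a normal subgroup of prime order\<close>

text \<open>\<open>index\<close> says that C_G(N) has index \<open>q\<close>. Since \<open>y\<close>
  acts nontrivially and has class size \<open>r\<close>, its centralizer is a complement of
  \<open>N\<close> in the group.\<close>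

locale prime_normal_action = group G for G :: "('a, 'b) monoid_scheme" (structure) +
  fixes N :: "'a set" and y :: 'a and q r :: nat
  assumes fin: "finite (carrier G)"
    and N: "N \<lhd> G" and card_N: "card N = r" and r: "Factorial_Ring.prime r"
    and q: "Factorial_Ring.prime q"
    and index: "card (carrier G) = q * card {g \<in> carrier G. centralizes g N}"
    and y: "y \<in> carrier G" and y_acts: "\<not> centralizes y N"
    and class_y: "card (conjugacy_class G y) = r"
begin

text \<open>The centralizer of the subgroup \<open>L\<close> defined next. Both contain
  \<open>y [^] q\<close>, so they need not intersect trivially.\<close>

definition K :: "'a set" where
  "K = {g \<in> carrier G. centralizes g N \<and> g \<in> centralizer G y}"

definition L :: "'a set" where
  "L = N <#> generate G {y}"

lemma N_subgroup: "subgroup N G"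
  using N normal_imp_subgroup by blast

lemma N_carrier: "N \<subseteq> carrier G"
  using N_subgroup subgroup.subset by blast

lemma C_normal: "{g \<in> carrier G. centralizes g N} \<lhd> G"
  using centralizes_subgroup_normal[OF N] .

lemma C_subgroup: "subgroup {g \<in> carrier G. centralizes g N} G"
  using C_normal normal_imp_subgroup by blast

lemma Y_subgroup: "subgroup (generate G {y}) G"
  using generate_is_subgroup y by blast

lemma Y_centralizer: "generate G {y} \<subseteq> centralizer G y"
  using generate_subgroup_incl[OF _ centralizer_subgroup[OF y]] centralizer_self[OF y] by blast

lemma N_int_centralizer: "N \<inter> centralizer G y = {\<one>}"
  using card_prime_normal_mult_centralizer(1)[OF fin N card_N r y y_acts] .

lemma y_pow: "centralizes (y [^] q) N"
  using pow_index_in_normal[OF fin C_normal index y] by blast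

lemma K_subgroup: "subgroup K G"
proof -
  have "K = {g \<in> carrier G. centralizes g N} \<inter> centralizer G y" by (auto simp: K_def)
  then show ?thesis using subgroups_Inter_pair[OF C_subgroup centralizer_subgroup[OF y]] by simp
qed

lemma L_subgroup: "subgroup L G"
  unfolding L_def using normal_set_mult[OF N Y_subgroup] .

lemma N_sub_L: "N \<subseteq> L" and y_in_L: "y \<in> L"
  using set_mult_incl[OF N_subgroup Y_subgroup] generate.incl[of y "{y}"] by (auto simp: L_def)

lemma K_int_N: "K \<inter> N \<subseteq> {\<one>}"
  using N_int_centralizer by (auto simp: K_def)

lemma K_centralizer_L:
  assumes k: "k \<in> K"
  shows "L \<subseteq> centralizer G k"
proof -
  have kc: "k \<in> carrier G" using k by (simp add: K_def)
  have "N \<subseteq> centralizer G k"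
    using k N_carrier kc centralizer_sym by (auto simp: K_def centralizes_def)
  moreover have "y \<in> centralizer G k" using k y kc centralizer_sym by (auto simp: K_def)
  then have "generate G {y} \<subseteq> centralizer G k"
    using generate_subgroup_incl[OF _ centralizer_subgroup[OF kc]] by blast
  ultimately show ?thesis unfolding L_def using set_mult_least[OF centralizer_subgroup[OF kc]] by blast
qed

lemma K_L_commute: "k \<in> K \<Longrightarrow> l \<in> L \<Longrightarrow> k \<otimes> l = l \<otimes> k"
  using K_centralizer_L by (fastforce simp: centralizer_def)

text \<open>Two factorizations are combined: G = N C(y) by counting, and G = C_G(N) <y> because
  C_G(N) has prime index. When an element of C(y) is factored in the second way, its part in C_G(N)
  is again in C(y), and so in \<open>K\<close>.\<close>

lemma K_mult_L: "K <#> L = carrier G"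
proof
  show "K <#> L \<subseteq> carrier G"
    using setmult_subset_G[OF subgroup.subset[OF K_subgroup] subgroup.subset[OF L_subgroup]] .
  have D: "subgroup (N <#> centralizer G y) G" using normal_set_mult[OF N centralizer_subgroup[OF y]] .
  have "card (N <#> centralizer G y) = card (carrier G)"
    using card_prime_normal_mult_centralizer(2)[OF fin N card_N r y y_acts]
      card_class_mult_centralizer[OF fin y] class_y by simp
  then have ND: "N <#> centralizer G y = carrier G" using card_subset_eq[OF fin subgroup.subset[OF D]] by simp
  let ?C = "{g \<in> carrier G. centralizes g N}"
  have E: "subgroup (?C <#> generate G {y}) G" using normal_set_mult[OF C_normal Y_subgroup] .
  have "y \<in> ?C <#> generate G {y}"
    using set_mult_incl(2)[OF C_subgroup Y_subgroup] generate.incl[of y "{y}"] by blast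
  then have "?C \<noteq> ?C <#> generate G {y}" using y_acts by blast
  then have CY: "?C <#> generate G {y} = carrier G"
    using subgroup_prime_index_maximal[OF fin C_subgroup E set_mult_incl(1)[OF C_subgroup Y_subgroup] _ index q]
    by metis
  show "carrier G \<subseteq> K <#> L"
  proof
    fix g assume "g \<in> carrier G"
    then have "g \<in> N <#> centralizer G y" using ND by simp
    then obtain n d where nd: "n \<in> N" "d \<in> centralizer G y" "g = n \<otimes> d" by (auto simp: set_mult_def)
    have dc: "d \<in> carrier G" using nd(2) centralizer_carrier by blast
    then have "d \<in> ?C <#> generate G {y}" using CY by simp
    then obtain c u where cu: "c \<in> ?C" "u \<in> generate G {y}" "d = c \<otimes> u" by (auto simp: set_mult_def)
    have carr: "c \<in> carrier G" "u \<in> carrier G" "n \<in> carrier G"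
      using cu subgroup.subset[OF Y_subgroup] nd N_carrier by auto
    have "c = d \<otimes> inv u" using cu(3) carr by (simp add: m_assoc)
    moreover have "d \<otimes> inv u \<in> centralizer G y"
      using subgroup.m_closed[OF centralizer_subgroup[OF y] nd(2)
        subgroup.m_inv_closed[OF centralizer_subgroup[OF y]]] Y_centralizer cu(2) by blast
    ultimately have cK: "c \<in> K" using cu(1) by (simp add: K_def)
    have "n \<in> L" using nd N_sub_L by blast
    then have "n \<otimes> c = c \<otimes> n" using K_L_commute[OF cK] by simp
    then have "g = c \<otimes> (n \<otimes> u)" using nd(3) cu(3) carr by (metis m_assoc)
    moreover have "n \<otimes> u \<in> L" using nd(1) cu(2) by (auto simp: L_def set_mult_def)
    ultimately show "g \<in> K <#> L" using cK unfolding set_mult_def by blast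
  qed
qed

lemma class_size_N:
  assumes n: "n \<in> N" "n \<noteq> \<one>"
  shows "card (conjugacy_class G n) = q"
proof -
  have nc: "n \<in> carrier G" using n N_carrier by blast
  have "centralizer G n = {g \<in> carrier G. centralizes g N}"
    using prime_order_centralizes_iff[OF fin N_subgroup card_N r n] centralizer_carrier by blast
  then have "card (conjugacy_class G n) * card {g \<in> carrier G. centralizes g N}
    = q * card {g \<in> carrier G. centralizes g N}"
    using card_class_mult_centralizer[OF fin nc] index by simp
  then show ?thesis using subgroup_card_pos[OF fin C_subgroup] by simp
qed

text \<open>The class of \<open>n\<close> stays in \<open>N\<close>, which meets \<open>K\<close>
  trivially. This formula is what restricts the class sizes of elements of \<open>K\<close>.\<close>

lemma class_size_K_mult_N:
  assumes k: "k \<in> K" and n: "n \<in> N" "n \<noteq> \<one>"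
  shows "card (conjugacy_class G (k \<otimes> n)) = card (conjugacy_class G k) * q"
proof -
  have "card (conjugacy_class G (k \<otimes> n)) = card (conjugacy_class G k) * card (conjugacy_class G n)"
  proof (rule central_product_class_size[OF K_subgroup L_subgroup K_L_commute K_mult_L k])
    show "n \<in> L" using n N_sub_L by blast
    fix a1 a2 b1 b2
    assume a: "a1 \<in> K" "a2 \<in> K" and b: "b1 \<in> conjugacy_class G n" "b2 \<in> conjugacy_class G n"
      and e: "a1 \<otimes> b1 = a2 \<otimes> b2"
    have nc: "n \<in> carrier G" using n N_carrier by blast
    have "conjugacy_class G n \<subseteq> N"
      using normal_conj_by[OF N n(1)] by (auto simp: conjugacy_class_eq[OF nc])
    then have bN: "b1 \<in> N" "b2 \<in> N" using b by auto
    have c: "a1 \<in> carrier G" "a2 \<in> carrier G" "b1 \<in> carrier G" "b2 \<in> carrier G"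
      using a bN N_carrier by (auto simp: K_def)
    have "inv a2 \<otimes> a1 = b2 \<otimes> inv b1"
      using e c by (metis inv_closed inv_solve_left inv_solve_right m_assoc m_closed)
    moreover have "inv a2 \<otimes> a1 \<in> K" "b2 \<otimes> inv b1 \<in> N"
      using a bN K_subgroup N_subgroup by (auto simp: subgroup.m_closed subgroup.m_inv_closed)
    ultimately have "inv a2 \<otimes> a1 = \<one>" using K_int_N by auto
    then show "a1 = a2" using c by (metis inv_closed inv_equality inv_inv)
  qed auto
  then show ?thesis using class_size_N[OF n] by simp
qed

text \<open>As \<open>r\<close> does not divide the class size, \<open>x\<close> centralizes
  \<open>N\<close>, which makes it an element of \<open>K\<close> times some \<open>n\<close> in
  \<open>N\<close>; a nontrivial \<open>n\<close> would contribute the factor \<open>q\<close>. It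
  serves to locate an element of class size \<open>p\<close>.\<close>

lemma coprime_class_in_K:
  assumes x: "x \<in> carrier G" and xq: "\<not> q dvd card (conjugacy_class G x)"
    and xr: "\<not> r dvd card (conjugacy_class G x)"
  shows "x \<in> K"
proof -
  have xN: "centralizes x N"
    using card_prime_normal_mult_centralizer(3)[OF fin N card_N r x] xr by blast
  have "x \<in> K <#> L" using x K_mult_L by simp
  then obtain k l where kl: "k \<in> K" "l \<in> L" "x = k \<otimes> l" by (auto simp: set_mult_def)
  then obtain n u where nu: "n \<in> N" "u \<in> generate G {y}" "l = n \<otimes> u" by (auto simp: L_def set_mult_def)
  have c: "k \<in> carrier G" "n \<in> carrier G" "u \<in> carrier G" "l \<in> carrier G"
    using kl nu N_carrier subgroup.subset[OF Y_subgroup] subgroup.subset[OF L_subgroup]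
    by (auto simp: K_def)
  let ?C = "{g \<in> carrier G. centralizes g N}"
  have NC: "centralizes n N"
  proof (cases "n = \<one>")
    case True
    then show ?thesis using subgroup.one_closed[OF C_subgroup] by simp
  next
    case False
    then show ?thesis
      using prime_order_centralizes_iff[OF fin N_subgroup card_N r nu(1) _ c(2)] centralizer_self[OF c(2)]
      by blast
  qed
  have "u = inv n \<otimes> (inv k \<otimes> x)" using kl(3) nu(3) c by (simp add: m_assoc[symmetric] inv_mult_group)
  moreover have "inv n \<otimes> (inv k \<otimes> x) \<in> ?C"
    using subgroup.m_closed[OF C_subgroup] subgroup.m_inv_closed[OF C_subgroup] NC xN kl(1) c x
    by (auto simp: K_def)
  ultimately have uK: "u \<in> K" using Y_centralizer nu(2) by (auto simp: K_def)
  then have kuK: "k \<otimes> u \<in> K" using kl K_subgroup by (simp add: subgroup.m_closed)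
  have "u \<otimes> n = n \<otimes> u" using K_L_commute[OF uK] nu N_sub_L by blast
  then have xe: "x = (k \<otimes> u) \<otimes> n" using kl(3) nu(3) c by (simp add: m_assoc)
  show ?thesis
  proof (cases "n = \<one>")
    case True
    then show ?thesis using xe kuK c by simp
  next
    case False
    then have "card (conjugacy_class G x) = card (conjugacy_class G (k \<otimes> u)) * q"
      unfolding xe using class_size_K_mult_N[OF kuK nu(1)] by blast
    then show ?thesis using xq by simp
  qed
qed

end

section \<open>Divisibility among the class sizes 1, p, q, r, pq, pr\<close>

context
  fixes p q r :: nat
  assumes p: "Factorial_Ring.prime p" and q: "Factorial_Ring.prime q" and r: "Factorial_Ring.prime r"
    and ne: "p \<noteq> q" "p \<noteq> r" "q \<noteq> r"
begin

private lemma not_dvd: "\<not> p dvd q" "\<not> p dvd r" "\<not> q dvd p" "\<not> q dvd r" "\<not> r dvd p" "\<not> r dvd q"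
  "\<not> p dvd 1" "\<not> q dvd 1" "\<not> r dvd 1"
  using p q r ne primes_dvd_imp_eq not_prime_unit by blast+

text \<open>Meant for an element of \<open>K\<close> and its product with a nontrivial element of
  \<open>N\<close>, of class sizes \<open>s\<close> and \<open>s * q\<close>.\<close>

lemma class_size_cofactor_q:
  assumes "s \<in> {1, p, q, r, p * q, p * r}" "s * q \<in> {1, p, q, r, p * q, p * r}"
  shows "s \<in> {1, p}"
proof -
  have "s * q = 1 \<or> s * q = p \<or> s * q = q \<or> s * q = r \<or> s * q = p * q \<or> s * q = p * r"
    using assms(2) by auto
  moreover have "\<not> q dvd p * r" using q not_dvd by (simp add: prime_dvd_mult_iff)
  then have "s * q \<noteq> 1" "s * q \<noteq> p" "s * q \<noteq> r" "s * q \<noteq> p * r"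
    using not_dvd by (metis dvd_triv_right)+
  ultimately have "s * q = q \<or> s * q = p * q" by blast
  then show ?thesis using prime_gt_0_nat[OF q] by auto
qed

text \<open>Meant for an element of the second direct factor and its product with an element of
  class size \<open>p\<close> in the first.\<close>

lemma class_size_cofactor_p:
  assumes "s \<in> {1, p, q, r, p * q, p * r}" "p * s \<in> {1, p, q, r, p * q, p * r}"
  shows "s \<in> {1, q, r}"
proof -
  have "p * s = 1 \<or> p * s = p \<or> p * s = q \<or> p * s = r \<or> p * s = p * q \<or> p * s = p * r"
    using assms(2) by auto
  moreover have "p * s \<noteq> 1" "p * s \<noteq> q" "p * s \<noteq> r"
    using not_dvd by (metis dvd_triv_left)+
  ultimately have "p * s = p \<or> p * s = p * q \<or> p * s = p * r" by blast
  then show ?thesis using prime_gt_0_nat[OF p] by auto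
qed

text \<open>Supplies the hypothesis \<open>sq\<close> of
  \<open>class_coset_not_centralizes\<close>.\<close>

lemma class_size_not_square:
  assumes "s \<in> {1, p, q, r, p * q, p * r}" shows "\<not> r * r dvd s"
proof
  assume d: "r * r dvd s"
  then have "r dvd s" by (rule dvd_mult_left)
  moreover have "\<not> r dvd p * q" using r not_dvd by (simp add: prime_dvd_mult_iff)
  ultimately have "s = r \<or> s = p * r" using assms not_dvd by auto
  then have "r * r dvd r * p" using d by (auto simp: mult.commute intro: dvd_mult2)
  then have "r dvd p" using prime_gt_0_nat[OF r] by simp
  then show False using not_dvd by blast
qed

text \<open>Identifies \<open>q\<close> and \<open>r\<close> as the exceptional pair.\<close>

lemma class_size_products:
  "q * r \<notin> {1, p, q, r, p * q, p * r}"
proof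
  assume "q * r \<in> {1, p, q, r, p * q, p * r}"
  then have "q * r = 1 \<or> q * r = p \<or> q * r = q \<or> q * r = r \<or> q * r = p * q \<or> q * r = p * r" by auto
  moreover have "q * r \<noteq> 1" "q * r \<noteq> p" "q * r \<noteq> q" "q * r \<noteq> r"
    using not_dvd by (metis dvd_triv_left dvd_triv_right)+
  moreover have "q * r \<noteq> p * q" "q * r \<noteq> p * r"
    using ne prime_gt_0_nat[OF q] prime_gt_0_nat[OF r] by auto
  ultimately show False by blast
qed

end

section \<open>Assembling the direct product\<close>

lemma (in group) ord_subgroup:
  assumes "subgroup S G" shows "group.ord (G\<lparr>carrier := S\<rparr>) x = ord x"
  unfolding ord_def group.ord_def[OF subgroup.subgroup_is_group[OF assms is_group]]
  by (simp add: nat_pow_consistent[symmetric])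

lemma (in group) cs_memI: "x \<in> carrier G \<Longrightarrow> card (conjugacy_class G x) \<in> cs G"
  by (auto simp: cs_def)

lemma (in group) centralizer_carrier_update:
  "S \<subseteq> carrier G \<Longrightarrow> centralizer (G\<lparr>carrier := S\<rparr>) x = S \<inter> centralizer G x"
  by (auto simp: centralizer_def)

text \<open>The elements of \<open>K\<close> of order prime to \<open>p\<close> form a subgroup
  \<open>?A\<close>, central in \<open>K\<close>. \<open>P\<close> is a complement of it in
  \<open>K\<close>, and \<open>H\<close> is \<open>L <#> ?A\<close>. The hypothesis on the order of
  \<open>y\<close> keeps the overlap of \<open>K\<close> and \<open>L\<close> inside
  \<open>?A\<close>.\<close>

lemma (in prime_normal_action) direct_product_structure:
  assumes p: "Factorial_Ring.prime p" and ne: "p \<noteq> q" "p \<noteq> r" "q \<noteq> r"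
    and cs: "cs G = {1, p, q, r, p * q, p * r}" and yp: "\<not> p dvd ord y"
  shows "\<exists>P H. internal_direct_product G P H \<and>
               p_group p (G\<lparr>carrier := P\<rparr>) \<and>
               nilpotent_group (G\<lparr>carrier := P\<rparr>) \<and>
               nilpotency_class (G\<lparr>carrier := P\<rparr>) \<le> 2 \<and>
               cs (G\<lparr>carrier := P\<rparr>) = {1, p} \<and>
               frobenius_group (G\<lparr>carrier := H\<rparr> Mod center (G\<lparr>carrier := H\<rparr>)) \<and>
               order (G\<lparr>carrier := H\<rparr> Mod center (G\<lparr>carrier := H\<rparr>)) = q * r \<and>
               cs (G\<lparr>carrier := H\<rparr>) = {1, q, r}"
proof -
  have Kc: "K \<subseteq> carrier G" and Lc: "L \<subseteq> carrier G"
    using subgroup.subset[OF K_subgroup] subgroup.subset[OF L_subgroup] by auto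
  have "card N \<noteq> 1" using card_N r by auto
  then have "N \<noteq> {\<one>}" by auto
  then obtain n where n: "n \<in> N" "n \<noteq> \<one>"
    using subgroup.one_closed[OF N_subgroup] by blast
  have nc: "n \<in> carrier G" using n N_carrier by blast
  have classK: "card (conjugacy_class G k) \<in> {1, p}" if k: "k \<in> K" for k
  proof -
    have "card (conjugacy_class G k) \<in> cs G" using cs_memI k Kc by blast
    moreover have "card (conjugacy_class G (k \<otimes> n)) \<in> cs G" using cs_memI k Kc nc by blast
    ultimately show ?thesis
      using class_size_K_mult_N[OF k n] class_size_cofactor_q[OF p q r ne] cs by simp
  qed
  interpret KG: group "G\<lparr>carrier := K\<rparr>" using subgroup.subgroup_is_group[OF K_subgroup is_group] .
  let ?A = "{x \<in> K. \<not> p dvd ord x}"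
  have KGfin: "finite (carrier (G\<lparr>carrier := K\<rparr>))" using finite_subset[OF Kc fin] by simp
  have "card (conjugacy_class (G\<lparr>carrier := K\<rparr>) x) \<in> {1, p}" if "x \<in> carrier (G\<lparr>carrier := K\<rparr>)" for x
    using central_product_class_left[OF K_subgroup L_subgroup K_L_commute K_mult_L] classK that by simp
  then have "\<exists>P a. subgroup P (G\<lparr>carrier := K\<rparr>) \<and> card P = p ^ a \<and> subgroup ?A (G\<lparr>carrier := K\<rparr>) \<and>
    (\<forall>z\<in>?A. \<forall>g\<in>K. z \<otimes> g = g \<otimes> z) \<and> P \<inter> ?A = {\<one>} \<and> P <#> ?A = K"
    using KG.prime_class_sizes_decomposition[OF KGfin p] by (simp add: ord_subgroup[OF K_subgroup])
  then obtain P a where PK: "subgroup P (G\<lparr>carrier := K\<rparr>)" and cP: "card P = p ^ a"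
    and AK: "subgroup ?A (G\<lparr>carrier := K\<rparr>)"
    and "\<forall>z\<in>?A. \<forall>g\<in>K. z \<otimes> g = g \<otimes> z"
    and PA: "P \<inter> ?A = {\<one>}" and P_A: "P <#> ?A = K" by blast
  then have A_K: "\<And>z g. z \<in> ?A \<Longrightarrow> g \<in> K \<Longrightarrow> z \<otimes> g = g \<otimes> z" by blast
  have P: "subgroup P G" and A: "subgroup ?A G"
    using incl_subgroup[OF K_subgroup] PK AK by auto
  have PsK: "P \<subseteq> K" using subgroup.subset[OF PK] by simp
  have Pc: "P \<subseteq> carrier G" using PsK Kc by blast
  let ?H = "L <#> ?A"
  have LA: "l \<otimes> z = z \<otimes> l" if "l \<in> L" "z \<in> ?A" for l z
    using K_L_commute[of z l] that by simp
  have H: "subgroup ?H G" by (rule set_mult_commuting_subgroup[OF L_subgroup A LA])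
  have Hc: "?H \<subseteq> carrier G" using subgroup.subset[OF H] .
  have LsH: "L \<subseteq> ?H" and AsH: "?A \<subseteq> ?H" using set_mult_incl[OF L_subgroup A] by auto
  have P_H: "x \<otimes> h = h \<otimes> x" if x: "x \<in> P" and h: "h \<in> ?H" for x h
  proof -
    have xc: "x \<in> carrier G" using x Pc by blast
    have "x \<otimes> z = z \<otimes> x" if "z \<in> ?A" for z using A_K[OF that, of x] x PsK by auto
    then have "?A \<subseteq> centralizer G x" using xc Kc by (fastforce simp: centralizer_def)
    moreover have "L \<subseteq> centralizer G x" using K_centralizer_L x PsK by blast
    ultimately have "?H \<subseteq> centralizer G x" using set_mult_least[OF centralizer_subgroup[OF xc]] by blast
    then have "h \<otimes> x = x \<otimes> h" using h unfolding centralizer_def by blast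
    then show ?thesis by (rule sym)
  qed
  have PH: "P <#> ?H = carrier G"
  proof
    show "P <#> ?H \<subseteq> carrier G" using setmult_subset_G[OF Pc Hc] .
    show "carrier G \<subseteq> P <#> ?H"
    proof
      fix g assume "g \<in> carrier G"
      then have "g \<in> K <#> L" using K_mult_L by simp
      then obtain k l where kl: "k \<in> K" "l \<in> L" "g = k \<otimes> l" by (auto simp: set_mult_def)
      have "k \<in> P <#> ?A" using kl P_A by simp
      then obtain x z where xz: "x \<in> P" "z \<in> ?A" "k = x \<otimes> z" unfolding set_mult_def by blast
      have c: "x \<in> carrier G" "z \<in> carrier G" "l \<in> carrier G" using xz kl Pc Kc Lc by auto
      have "g = x \<otimes> (l \<otimes> z)" using kl(3) xz(3) LA[OF kl(2) xz(2)] c by (simp add: m_assoc)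
      moreover have "l \<otimes> z \<in> ?H" using kl(2) xz(2) unfolding set_mult_def by blast
      ultimately show "g \<in> P <#> ?H" using xz(1) unfolding set_mult_def by blast
    qed
  qed
  \<comment> \<open>An element of the intersection has its \<open>L\<close>-part \<open>l\<close> in
    \<open>K\<close>. The component of \<open>l\<close> in \<open>N\<close> then centralizes
    \<open>y\<close> and is trivial, so \<open>l\<close> is a power of \<open>y\<close>, of order
    prime to \<open>p\<close>, and lies in \<open>?A\<close>.\<close>
  have PintH: "P \<inter> ?H = {\<one>}"
  proof
    show "P \<inter> ?H \<subseteq> {\<one>}"
    proof
      fix z assume z: "z \<in> P \<inter> ?H"
      then obtain l b where lb: "l \<in> L" "b \<in> ?A" "z = l \<otimes> b" unfolding set_mult_def by blast
      then obtain m u where mu: "m \<in> N" "u \<in> generate G {y}" "l = m \<otimes> u"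
        unfolding L_def set_mult_def by blast
      have c: "l \<in> carrier G" "b \<in> carrier G" "m \<in> carrier G" "u \<in> carrier G" "z \<in> carrier G"
        using lb mu Kc Lc N_carrier subgroup.subset[OF Y_subgroup] z Pc by auto
      have "l = z \<otimes> inv b" using lb(3) c by (simp add: m_assoc)
      moreover have "z \<in> K" "b \<in> K" using z PsK lb(2) by auto
      ultimately have lK: "l \<in> K" using K_subgroup by (simp add: subgroup.m_closed subgroup.m_inv_closed)
      have "m = l \<otimes> inv u" using mu(3) c by (simp add: m_assoc)
      moreover have "l \<in> centralizer G y" "u \<in> centralizer G y"
        using lK Y_centralizer mu(2) by (auto simp: K_def)
      ultimately have "m \<in> centralizer G y" using centralizer_subgroup[OF y]
        by (simp add: subgroup.m_closed subgroup.m_inv_closed)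
      then have "m = \<one>" using N_int_centralizer mu(1) by blast
      then have lu: "l = u" using mu(3) c by simp
      obtain i :: nat where "u = y [^] i"
        using mu(2) generate_pow_on_finite_carrier[OF fin y] by auto
      then have "u [^] ord y = (y [^] ord y) [^] i" using y by (simp add: nat_pow_pow mult.commute del: pow_ord_eq_1)
      then have "u [^] ord y = \<one>" using y by simp
      then have "ord u dvd ord y" using pow_eq_id c by blast
      then have "u \<in> ?A" using lK lu yp dvd_trans by blast
      then have "u \<otimes> b \<in> ?A" using subgroup.m_closed[OF A _ lb(2)] by blast
      then have "z \<in> ?A" using lb(3) lu by simp
      then show "z \<in> {\<one>}" using z PA by blast
    qed
    show "{\<one>} \<subseteq> P \<inter> ?H" using subgroup.one_closed[OF P] subgroup.one_closed[OF H] by simp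
  qed
  have HP: "?H <#> P = carrier G"
  proof -
    have "x \<otimes> h \<in> ?H <#> P" if "x \<in> P" "h \<in> ?H" for x h
      using that P_H[OF that] unfolding set_mult_def[of G ?H P] by auto
    then have "P <#> ?H \<subseteq> ?H <#> P" unfolding set_mult_def[of G P ?H] by blast
    then show ?thesis using PH setmult_subset_G[OF Hc Pc] by auto
  qed
  have idp: "internal_direct_product G P ?H"
  proof -
    interpret ds: group_disjoint_sum G P ?H
      using P H is_group by (simp add: group_disjoint_sum_def)
    have "P \<lhd> G \<and> ?H \<lhd> G" using ds.normal_eq_commuting PH PintH P_H by blast
    then show ?thesis using PH PintH by (simp add: internal_direct_product_def)
  qed
  have classP: "conjugacy_class (G\<lparr>carrier := P\<rparr>) x = conjugacy_class G x" if "x \<in> P" for x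
    using central_product_class_left[OF P H P_H PH that] .
  have classH: "conjugacy_class (G\<lparr>carrier := ?H\<rparr>) h = conjugacy_class G h" if "h \<in> ?H" for h
    using central_product_class_left[OF H P _ HP that] P_H by metis
  have classPH: "card (conjugacy_class G (x \<otimes> h))
      = card (conjugacy_class G x) * card (conjugacy_class G h)" if x: "x \<in> P" and h: "h \<in> ?H" for x h
  proof (rule central_product_class_size[OF P H P_H PH x h])
    fix a1 a2 b1 b2
    assume a: "a1 \<in> P" "a2 \<in> P" and b: "b1 \<in> conjugacy_class G h" "b2 \<in> conjugacy_class G h"
      and e: "a1 \<otimes> b1 = a2 \<otimes> b2"
    have "conjugacy_class G h = (\<lambda>g. conj_by G g h) ` ?H"
      using classH[OF h] conjugacy_class_subgroup[OF H h] by simp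
    then have "conjugacy_class G h \<subseteq> ?H"
      using h H by (auto simp: conj_by_def subgroup.m_closed subgroup.m_inv_closed)
    then have bH: "b1 \<in> ?H" "b2 \<in> ?H" using b by auto
    have c: "a1 \<in> carrier G" "a2 \<in> carrier G" "b1 \<in> carrier G" "b2 \<in> carrier G"
      using a bH Pc Hc by auto
    have "inv a2 \<otimes> a1 = b2 \<otimes> inv b1"
      using e c by (metis inv_closed inv_solve_left inv_solve_right m_assoc m_closed)
    moreover have "inv a2 \<otimes> a1 \<in> P" "b2 \<otimes> inv b1 \<in> ?H"
      using a bH P H by (auto simp: subgroup.m_closed subgroup.m_inv_closed)
    ultimately have "inv a2 \<otimes> a1 = \<one>" using PintH by auto
    then show "a1 = a2" using c by (metis inv_closed inv_equality inv_inv)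
  qed auto
  \<comment> \<open>An element of class size \<open>p\<close> lies in \<open>K\<close>, and its part
    in \<open>?A\<close> is central in the whole group; removing it leaves an element of
    \<open>P\<close> with the same class size.\<close>
  obtain x0 where x0: "x0 \<in> P" "card (conjugacy_class G x0) = p"
  proof -
    have "p \<in> cs G" using cs by simp
    then obtain x where x: "x \<in> carrier G" "card (conjugacy_class G x) = p"
      unfolding cs_def by blast
    have "\<not> q dvd p" "\<not> r dvd p" using p q r ne primes_dvd_imp_eq by blast+
    then have "x \<in> K" using coprime_class_in_K[OF x(1)] x(2) by simp
    then have "x \<in> P <#> ?A" using P_A by simp
    then obtain w z where wz: "w \<in> P" "z \<in> ?A" "x = w \<otimes> z" unfolding set_mult_def by blast
    have zH: "z \<in> ?H" using wz AsH by blast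
    have zc: "z \<in> carrier G" using zH Hc by blast
    have "\<forall>g\<in>carrier G. g \<in> centralizer G z"
    proof -
      have "L \<subseteq> centralizer G z" using K_centralizer_L wz(2) by blast
      moreover have "K \<subseteq> centralizer G z"
      proof
        fix k assume k: "k \<in> K"
        have "k \<otimes> z = z \<otimes> k" using A_K[OF wz(2) k] by (rule sym)
        then show "k \<in> centralizer G z" using k Kc unfolding centralizer_def by blast
      qed
      ultimately show ?thesis
        using set_mult_least[OF centralizer_subgroup[OF zc], of K L] K_mult_L by blast
    qed
    then have "card (conjugacy_class G z) = 1" using class_size_one_iff[OF fin zc] by blast
    then have "card (conjugacy_class G w) = p" using classPH[OF wz(1) zH] x(2) wz(3) by simp
    then show ?thesis using that wz(1) by blast
  qed
  have one_size: "card (conjugacy_class G \<one>) = 1"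
    using class_size_one_iff[OF fin one_closed] by (simp add: centralizer_def)
  have csP: "cs (G\<lparr>carrier := P\<rparr>) = {1, p}"
  proof
    show "cs (G\<lparr>carrier := P\<rparr>) \<subseteq> {1, p}"
    proof
      fix s assume "s \<in> cs (G\<lparr>carrier := P\<rparr>)"
      then obtain x where x: "x \<in> P" "s = card (conjugacy_class G x)"
        using classP unfolding cs_def by auto
      then show "s \<in> {1, p}" using classK[of x] PsK by blast
    qed
    have "card (conjugacy_class (G\<lparr>carrier := P\<rparr>) x) \<in> cs (G\<lparr>carrier := P\<rparr>)" if "x \<in> P" for x
      using that unfolding cs_def by auto
    from this[OF x0(1)] this[OF subgroup.one_closed[OF P]]
    show "{1, p} \<subseteq> cs (G\<lparr>carrier := P\<rparr>)"
      using classP x0 subgroup.one_closed[OF P] one_size by simp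
  qed
  have nH: "n \<in> ?H" "y \<in> ?H" "\<one> \<in> ?H"
    using n N_sub_L y_in_L LsH subgroup.one_closed[OF H] by auto
  have csH: "cs (G\<lparr>carrier := ?H\<rparr>) = {1, q, r}"
  proof
    show "cs (G\<lparr>carrier := ?H\<rparr>) \<subseteq> {1, q, r}"
    proof
      fix s assume "s \<in> cs (G\<lparr>carrier := ?H\<rparr>)"
      then obtain h where h: "h \<in> ?H" "s = card (conjugacy_class G h)"
        using classH unfolding cs_def by auto
      have "s \<in> cs G" using cs_memI h Hc by blast
      moreover have "p * s \<in> cs G"
        using cs_memI[of "x0 \<otimes> h"] classPH[OF x0(1) h(1)] x0 h Pc Hc by auto
      ultimately show "s \<in> {1, q, r}" using class_size_cofactor_p[OF p q r ne] cs by simp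
    qed
    have "card (conjugacy_class (G\<lparr>carrier := ?H\<rparr>) h) \<in> cs (G\<lparr>carrier := ?H\<rparr>)" if "h \<in> ?H" for h
      using that unfolding cs_def by auto
    from this[OF nH(1)] this[OF nH(2)] this[OF nH(3)]
    show "{1, q, r} \<subseteq> cs (G\<lparr>carrier := ?H\<rparr>)"
      using classH nH class_size_N[OF n] class_y one_size by simp
  qed
  interpret PG: group "G\<lparr>carrier := P\<rparr>" using subgroup.subgroup_is_group[OF P is_group] .
  have lc: "lower_central (G\<lparr>carrier := P\<rparr>) 2 = {\<one>\<^bsub>G\<lparr>carrier := P\<rparr>\<^esub>}"
  proof (rule PG.lower_central_2_trivial)
    fix x a' b' assume "x \<in> carrier (G\<lparr>carrier := P\<rparr>)" "a' \<in> carrier (G\<lparr>carrier := P\<rparr>)"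
      "b' \<in> carrier (G\<lparr>carrier := P\<rparr>)"
    then show "conj_by (G\<lparr>carrier := P\<rparr>) a' b' \<otimes>\<^bsub>G\<lparr>carrier := P\<rparr>\<^esub> inv\<^bsub>G\<lparr>carrier := P\<rparr>\<^esub> b'
        \<in> centralizer (G\<lparr>carrier := P\<rparr>) x"
      by (rule PG.p_group_prime_class_sizes_commutators[rotated -3])
        (use finite_subset[OF Pc fin] p cP classP classK PsK in auto)
  qed
  interpret HG: group "G\<lparr>carrier := ?H\<rparr>" using subgroup.subgroup_is_group[OF H is_group] .
  let ?HG = "G\<lparr>carrier := ?H\<rparr>"
  have HGfin: "finite (carrier ?HG)" using finite_subset[OF Hc fin] by simp
  \<comment> \<open>Such a \<open>z\<close> lies in \<open>K\<close>, hence commutes with both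
    \<open>L\<close> and \<open>?A\<close>.\<close>
  have center_H: "z \<in> center ?HG" if z: "z \<in> ?H" "centralizes z N" "z \<in> centralizer G y" for z
  proof -
    have zc: "z \<in> carrier G" using z Hc by blast
    have zK: "z \<in> K" using z zc by (simp add: K_def)
    have "?A \<subseteq> centralizer G z"
    proof
      fix b assume b: "b \<in> ?A"
      then have "b \<otimes> z = z \<otimes> b" using A_K zK by blast
      then show "b \<in> centralizer G z" using b Kc unfolding centralizer_def by blast
    qed
    then have "?H \<subseteq> centralizer G z"
      using set_mult_least[OF centralizer_subgroup[OF zc] K_centralizer_L[OF zK]] by blast
    then have "z \<otimes> h = h \<otimes> z" if "h \<in> ?H" for h
    proof -
      have "h \<otimes> z = z \<otimes> h" using \<open>?H \<subseteq> centralizer G z\<close> that unfolding centralizer_def by blast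
      then show ?thesis by (rule sym)
    qed
    then show ?thesis using z unfolding center_def by simp
  qed
  \<comment> \<open>In \<open>?HG\<close> the elements \<open>n\<close> and \<open>y\<close> have
    the coprime class sizes \<open>q\<close> and \<open>r\<close>, so their centralizers intersect
    in a subgroup of index \<open>q * r\<close>; this subgroup turns out to be the centre.\<close>
  have "coprime (card (conjugacy_class ?HG n)) (card (conjugacy_class ?HG y))"
    using classH nH class_size_N[OF n] class_y primes_coprime q r ne by simp
  then have "q * r * card (centralizer ?HG n \<inter> centralizer ?HG y) = card (carrier ?HG)"
    using HG.coprime_index_centralizers(2)[OF HGfin, of n y] nH classH class_size_N[OF n] class_y by simp
  moreover have "centralizer ?HG n \<inter> centralizer ?HG y = center ?HG"
  proof
    show "centralizer ?HG n \<inter> centralizer ?HG y \<subseteq> center ?HG"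
    proof
      fix z assume "z \<in> centralizer ?HG n \<inter> centralizer ?HG y"
      then have "z \<in> ?H" "z \<in> centralizer G n" "z \<in> centralizer G y"
        using centralizer_carrier_update[OF Hc] by auto
      then show "z \<in> center ?HG"
        using center_H prime_order_centralizes_iff[OF fin N_subgroup card_N r n] Hc by blast
    qed
    show "center ?HG \<subseteq> centralizer ?HG n \<inter> centralizer ?HG y"
      using HG.center_centralizer(1) nH by auto
  qed
  ultimately have cH: "card (carrier ?HG) = q * r * card (center ?HG)" by simp
  have NH: "N \<lhd> ?HG"
  proof (rule HG.normalI_conj_by)
    show "subgroup N ?HG" using subgroup_incl[OF N_subgroup H] N_sub_L LsH by blast
    fix g m assume "g \<in> carrier ?HG" "m \<in> N"
    then show "conj_by ?HG g m \<in> N"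
      using conj_by_subgroup_carrier[OF H] normal_conj_by[OF N] Hc by auto
  qed
  have "N \<inter> centralizer ?HG y = {\<one>\<^bsub>?HG\<^esub>}"
    using N_int_centralizer centralizer_carrier_update[OF Hc] N_sub_L LsH by auto
  moreover have "y [^]\<^bsub>?HG\<^esub> q \<in> center ?HG"
    using center_H[of "y [^] q"] pow_in_subgroup[OF H nH(2)] y_pow
      pow_in_subgroup[OF centralizer_subgroup[OF y] centralizer_self[OF y]]
    by (simp add: nat_pow_consistent[symmetric])
  ultimately have frob: "frobenius_group (?HG Mod center ?HG)" "order (?HG Mod center ?HG) = q * r"
    using HG.frobenius_mod_center[OF HGfin NH card_N r _ _ q _ ne(3) cH] nH(2) by simp_all
  have "p_group p (G\<lparr>carrier := P\<rparr>)"
    unfolding p_group_def using PG.is_group cP by (auto simp: order_def)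
  moreover have "nilpotent_group (G\<lparr>carrier := P\<rparr>)"
    unfolding nilpotent_group_def using PG.is_group lc by blast
  moreover have "nilpotency_class (G\<lparr>carrier := P\<rparr>) \<le> 2"
    unfolding nilpotency_class_def by (rule Least_le) (rule lc)
  ultimately show ?thesis using idp csP csH frob by blast
qed

section \<open>Groups with two composite class sizes\<close>

lemma prime_mult_eq_iff:
  fixes a b c d :: nat
  assumes "Factorial_Ring.prime a" "Factorial_Ring.prime b" "Factorial_Ring.prime c" "Factorial_Ring.prime d"
  shows "a * b = c * d \<longleftrightarrow> {a, b} = {c, d}"
proof
  assume e: "a * b = c * d"
  then have "a dvd c * d" by (metis dvd_triv_left)
  then have "a = c \<or> a = d" using assms by (metis prime_dvd_mult_iff primes_dvd_imp_eq)
  then show "{a, b} = {c, d}"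
    using e prime_gt_0_nat[OF assms(1)] by (auto simp: mult.commute)
qed (auto simp: doubleton_eq_iff)

lemma composite_prime_mult:
  assumes "Factorial_Ring.prime (a::nat)" "Factorial_Ring.prime b" shows "composite (a * b)"
proof -
  have "a dvd a * b" "a \<noteq> 1" "a \<noteq> a * b" "a * b > 0"
    using prime_gt_1_nat[OF assms(1)] prime_gt_1_nat[OF assms(2)] by auto
  then show ?thesis unfolding composite_def by blast
qed

context group
begin

text \<open>Both orderings of \<open>p\<close> and \<open>q\<close> are merged: the commutators of
  \<open>x\<close> lie in \<open>N\<close> whichever class is larger. For \<open>q < p\<close> the
  reason is that the class of \<open>x\<close> is a coset of \<open>N\<close>.\<close>

lemma incompatible_class_sizes:
  assumes fin: "finite (carrier G)" and x: "x \<in> carrier G" and y: "y \<in> carrier G"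
    and p: "Factorial_Ring.prime (p::nat)" "card (conjugacy_class G x) = p"
    and q: "Factorial_Ring.prime (q::nat)" "card (conjugacy_class G y) = q"
    and pq: "p \<noteq> q" "p * q \<notin> cs G"
  shows "\<exists>N. N \<lhd> G \<and> card N = max p q \<and> (\<forall>g\<in>carrier G. inv x \<otimes> conj_by G g x \<in> N) \<and>
    (q < p \<longrightarrow> centralizer G y = {g \<in> carrier G. centralizes g N})"
proof (cases "p < q")
  case True
  have "card (conjugacy_class G (x \<otimes> y)) \<noteq> p * q" using cs_memI[of "x \<otimes> y"] x y pq(2) by auto
  then obtain N where "N \<lhd> G" "card N = q" "\<And>g. g \<in> carrier G \<Longrightarrow> inv x \<otimes> conj_by G g x \<in> N"
    using small_coprime_classes[OF fin x y p q True] by metis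
  then show ?thesis using True by (intro exI[of _ N]) auto
next
  case False
  then have qp: "q < p" using pq(1) by simp
  have "card (conjugacy_class G (y \<otimes> x)) \<noteq> q * p"
    using cs_memI[of "y \<otimes> x"] x y pq(2) by (auto simp: mult.commute)
  then obtain N where N: "N \<lhd> G" "card N = p" "conjugacy_class G x = N #> x"
    "\<And>g. g \<in> carrier G \<Longrightarrow> centralizes g N \<longleftrightarrow> g \<in> centralizer G y"
    using small_coprime_classes[OF fin y x q p qp] by metis
  have "inv x \<otimes> conj_by G g x \<in> N" if g: "g \<in> carrier G" for g
  proof -
    have "conj_by G g x \<in> N #> x" using conjugacy_classI[OF x g] N(3) by simp
    then obtain n where n: "n \<in> N" "conj_by G g x = n \<otimes> x" by (auto simp: r_coset_def)
    have nc: "n \<in> carrier G" using n subgroup.subset[OF normal_imp_subgroup[OF N(1)]] by blast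
    have "inv x \<otimes> conj_by G g x = conj_by G (inv x) n"
      using n nc x by (simp add: conj_by_def m_assoc)
    then show ?thesis using normal_conj_by[OF N(1) n(1), of "inv x"] x by simp
  qed
  moreover have "centralizer G y = {g \<in> carrier G. centralizes g N}"
    using N(4) centralizer_carrier by blast
  ultimately show ?thesis using N qp by (intro exI[of _ N]) auto
qed

text \<open>If \<open>a\<close> formed exceptional pairs with both \<open>b\<close> and
  \<open>c\<close>, a nontrivial commutator of \<open>x\<close> would generate both normal
  subgroups, so they would coincide. Equality of their orders makes \<open>a\<close> the largest of
  the three primes; then \<open>y\<close> and \<open>z\<close> have the same centralizer C_G(N),
  against \<open>b \<noteq> c\<close>.\<close>

lemma incompatible_class_size_unique:
  assumes fin: "finite (carrier G)"
    and primes: "Factorial_Ring.prime (a::nat)" "Factorial_Ring.prime b" "Factorial_Ring.prime c"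
    and ne: "a \<noteq> b" "a \<noteq> c" "b \<noteq> c" and mem: "a \<in> cs G" "b \<in> cs G" "c \<in> cs G"
  shows "a * b \<in> cs G \<or> a * c \<in> cs G"
proof (rule ccontr)
  assume n: "\<not> (a * b \<in> cs G \<or> a * c \<in> cs G)"
  obtain x where x: "x \<in> carrier G" "card (conjugacy_class G x) = a" using mem(1) by (auto simp: cs_def)
  obtain y where y: "y \<in> carrier G" "card (conjugacy_class G y) = b" using mem(2) by (auto simp: cs_def)
  obtain z where z: "z \<in> carrier G" "card (conjugacy_class G z) = c" using mem(3) by (auto simp: cs_def)
  obtain N where N: "N \<lhd> G" "card N = max a b" "\<forall>g\<in>carrier G. inv x \<otimes> conj_by G g x \<in> N"
    "b < a \<longrightarrow> centralizer G y = {g \<in> carrier G. centralizes g N}"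
    using incompatible_class_sizes[OF fin x(1) y(1) primes(1) x(2) primes(2) y(2) ne(1)] n by blast
  obtain M where M: "M \<lhd> G" "card M = max a c" "\<forall>g\<in>carrier G. inv x \<otimes> conj_by G g x \<in> M"
    "c < a \<longrightarrow> centralizer G z = {g \<in> carrier G. centralizes g M}"
    using incompatible_class_sizes[OF fin x(1) z(1) primes(1) x(2) primes(3) z(2) ne(2)] n by blast
  have "\<exists>g\<in>carrier G. g \<notin> centralizer G x"
    using class_size_one_iff[OF fin x(1)] x(2) prime_gt_1_nat[OF primes(1)] by fastforce
  then obtain g where g: "g \<in> carrier G" "conj_by G g x \<noteq> x" using conj_by_fixed_iff x(1) by blast
  define v where "v = inv x \<otimes> conj_by G g x"
  have "x \<otimes> v = conj_by G g x" using g x by (simp add: v_def m_assoc[symmetric])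
  then have v1: "v \<noteq> \<one>" using g x(1) by auto
  have v: "v \<in> N" "v \<in> M" using N(3) M(3) g v_def by auto
  have Ns: "subgroup N G" and Ms: "subgroup M G" using N M normal_imp_subgroup by auto
  have pm: "Factorial_Ring.prime (max a b)" "Factorial_Ring.prime (max a c)"
    using primes by (auto simp: max_def)
  have "N \<subseteq> M" using prime_order_subset[OF fin Ns N(2) pm(1) v(1) v1 Ms v(2)] .
  moreover have "M \<subseteq> N" using prime_order_subset[OF fin Ms M(2) pm(2) v(2) v1 Ns v(1)] .
  ultimately have NM: "N = M" by blast
  then have "max a b = max a c" using N(2) M(2) by simp
  then have lt: "b < a" "c < a" using ne by (auto simp: max_def split: if_splits)
  then have "centralizer G y = centralizer G z" using N(4) M(4) NM by simp
  then have "card (conjugacy_class G y) dvd card (conjugacy_class G z)"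
    using class_size_dvd[OF fin z(1) y(1)] by simp
  then show False using y z primes ne primes_dvd_imp_eq by blast
qed

text \<open>The larger prime \<open>r\<close> of the exceptional pair is the order of
  \<open>N\<close>, and the class of \<open>z\<close> is a coset of \<open>N\<close>. The role of
  the acting element goes to a power of \<open>z\<close> whose order is prime to
  \<open>p\<close>.\<close>

lemma ordered_class_sizes_structure:
  assumes fin: "finite (carrier G)"
    and primes: "Factorial_Ring.prime p" "Factorial_Ring.prime q" "Factorial_Ring.prime r"
    and ne: "p \<noteq> q" "p \<noteq> r" and qr: "q < r"
    and cs: "cs G = {1, p, q, r, p * q, p * r}"
  shows "\<exists>P H. internal_direct_product G P H \<and>
               p_group p (G\<lparr>carrier := P\<rparr>) \<and>
               nilpotent_group (G\<lparr>carrier := P\<rparr>) \<and>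
               nilpotency_class (G\<lparr>carrier := P\<rparr>) \<le> 2 \<and>
               cs (G\<lparr>carrier := P\<rparr>) = {1, p} \<and>
               frobenius_group (G\<lparr>carrier := H\<rparr> Mod center (G\<lparr>carrier := H\<rparr>)) \<and>
               order (G\<lparr>carrier := H\<rparr> Mod center (G\<lparr>carrier := H\<rparr>)) = q * r \<and>
               cs (G\<lparr>carrier := H\<rparr>) = {1, q, r}"
proof -
  have ne3: "q \<noteq> r" using qr by simp
  have "q \<in> cs G" "r \<in> cs G" using cs by auto
  then obtain x z where x: "x \<in> carrier G" "card (conjugacy_class G x) = q"
    and z: "z \<in> carrier G" "card (conjugacy_class G z) = r" unfolding cs_def by blast
  have "q * r \<notin> cs G" unfolding cs by (rule class_size_products[OF primes ne ne3])
  then have "card (conjugacy_class G (x \<otimes> z)) \<noteq> q * r" using cs_memI[of "x \<otimes> z"] x z by auto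
  then obtain N where N: "N \<lhd> G" "card N = r" "conjugacy_class G z = N #> z"
    "\<And>g. g \<in> carrier G \<Longrightarrow> centralizes g N \<longleftrightarrow> g \<in> centralizer G x"
    using small_coprime_classes[OF fin x(1) z(1) primes(2) x(2) primes(3) z(2) qr] by metis
  let ?C = "{g \<in> carrier G. centralizes g N}"
  have "?C = centralizer G x" using N(4) centralizer_carrier by blast
  then have index: "card (carrier G) = q * card ?C"
    using card_class_mult_centralizer[OF fin x(1)] x(2) by simp
  have C: "?C \<lhd> G" using centralizes_subgroup_normal[OF N(1)] .
  have Cs: "subgroup ?C G" using C normal_imp_subgroup by blast
  have "\<exists>g\<in>carrier G. g \<notin> centralizer G x"
    using class_size_one_iff[OF fin x(1)] x(2) prime_gt_1_nat[OF primes(2)] by fastforce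
  then obtain c where c: "c \<in> carrier G" "\<not> centralizes c N" using N(4) by blast
  have "\<not> r * r dvd card (conjugacy_class G c)"
    using class_size_not_square[OF primes ne ne3] cs_memI[OF c(1)] cs by simp
  then have zN: "\<not> centralizes z N"
    using class_coset_not_centralizes[OF fin N(1,2) primes(3) z(1) N(3) c] by blast
  have "ord z > 0" using ord_ge_1[OF fin z(1)] by simp
  then obtain m where m: "ord z = m * p ^ multiplicity p (ord z)" "\<not> p dvd m"
    using prime_power_decomposition primes(1) by blast
  \<comment> \<open>\<open>k\<close> is the \<open>p\<close>-part of the order of \<open>z\<close>.
    As \<open>z [^] q\<close> centralizes \<open>N\<close> and \<open>k\<close> is coprime to
    \<open>q\<close>, the power \<open>y\<close> still acts nontrivially on \<open>N\<close>. Its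
    class size divides \<open>r\<close> and is not 1.\<close>
  define k where "k = p ^ multiplicity p (ord z)"
  define y where "y = z [^] k"
  have k0: "k \<noteq> 0" using prime_gt_0_nat[OF primes(1)] by (simp add: k_def)
  have yc: "y \<in> carrier G" using z y_def by simp
  have "ord y = m" unfolding y_def using ord_pow[OF z(1), of k] m(1) k0
    by (metis k_def dvd_triv_right nonzero_mult_div_cancel_right)
  then have yp: "\<not> p dvd ord y" using m by simp
  have yN: "\<not> centralizes y N"
  proof
    assume "centralizes y N"
    then have "z [^] k \<in> ?C" using yc y_def by simp
    moreover have "z [^] q \<in> ?C" using pow_index_in_normal[OF fin C index z(1)] .
    moreover have "coprime k q"
      unfolding k_def using primes_coprime[OF primes(1,2) ne(1)] by simp
    ultimately have "z \<in> ?C" using pow_coprime_in_subgroup[OF Cs z(1)] by blast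
    then show False using zN by blast
  qed
  have "centralizer G z \<subseteq> centralizer G y" unfolding y_def using centralizer_pow[OF z(1)] by blast
  then have "card (conjugacy_class G y) dvd r" using class_size_dvd[OF fin z(1) yc] z(2) by simp
  moreover have "card (conjugacy_class G y) \<noteq> 1"
  proof
    assume "card (conjugacy_class G y) = 1"
    then have all: "\<forall>g\<in>carrier G. g \<in> centralizer G y" using class_size_one_iff[OF fin yc] by blast
    have "N \<subseteq> carrier G" using subgroup.subset[OF normal_imp_subgroup[OF N(1)]] .
    then have "centralizes y N" unfolding centralizes_def using all yc centralizer_sym by blast
    then show False using yN by blast
  qed
  ultimately have cy: "card (conjugacy_class G y) = r" using primes(3) by (auto simp: prime_nat_iff)
  interpret prime_normal_action G N y q r
    by (intro prime_normal_action.intro prime_normal_action_axioms.intro is_group fin N primes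
        index yc yN cy)
  show ?thesis using direct_product_structure[OF primes(1) ne ne3 cs yp] .
qed

text \<open>The conclusion is symmetric in \<open>q\<close> and \<open>r\<close>, so the two may be
  ordered by size.\<close>

lemma class_sizes_structure:
  assumes fin: "finite (carrier G)"
    and primes: "Factorial_Ring.prime p" "Factorial_Ring.prime q" "Factorial_Ring.prime r"
    and ne: "p \<noteq> q" "p \<noteq> r" "q \<noteq> r"
    and cs: "cs G = {1, p, q, r, p * q, p * r}"
  shows "\<exists>P H. internal_direct_product G P H \<and>
               p_group p (G\<lparr>carrier := P\<rparr>) \<and>
               nilpotent_group (G\<lparr>carrier := P\<rparr>) \<and>
               nilpotency_class (G\<lparr>carrier := P\<rparr>) \<le> 2 \<and>
               cs (G\<lparr>carrier := P\<rparr>) = {1, p} \<and>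
               frobenius_group (G\<lparr>carrier := H\<rparr> Mod center (G\<lparr>carrier := H\<rparr>)) \<and>
               order (G\<lparr>carrier := H\<rparr> Mod center (G\<lparr>carrier := H\<rparr>)) = q * r \<and>
               cs (G\<lparr>carrier := H\<rparr>) = {1, q, r}"
proof (cases "q < r")
  case True
  then show ?thesis using ordered_class_sizes_structure[OF fin primes ne(1,2) _ cs] by blast
next
  case False
  then have rq: "r < q" using ne by simp
  have "cs G = {1, p, r, q, p * r, p * q}" using cs by (simp add: insert_commute)
  then show ?thesis
    using ordered_class_sizes_structure[OF fin primes(1,3,2) ne(2,1) rq]
    unfolding mult.commute[of q r] insert_commute[of q r "{}"] by blast
qed

text \<open>The trivial subgroup serves as the abelian factor.\<close>

lemma up_to_abelian_direct_factorsI: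
  assumes "\<Phi> G" shows "up_to_abelian_direct_factors \<Phi> G"
proof -
  have "carrier G <#> {\<one>} = carrier G"
    using coset_mult_one[of "carrier G"] by (simp add: r_coset_eq_set_mult)
  moreover have "carrier G \<inter> {\<one>} = {\<one>}" by auto
  ultimately have "internal_direct_product G (carrier G) {\<one>}"
    using normal_self one_is_normal by (simp add: internal_direct_product_def)
  moreover have "comm_group (G\<lparr>carrier := {\<one>}\<rparr>)"
    by (rule group.group_comm_groupI) (use subgroup.subgroup_is_group[OF triv_subgroup is_group] in auto)
  moreover have "G\<lparr>carrier := carrier G\<rparr> = G" by simp
  ultimately show ?thesis using assms unfolding up_to_abelian_direct_factors_def by metis
qed

text \<open>Among four primes each occurs in at most one exceptional pair. So at least two of
  \<open>a * b\<close>, \<open>a * c\<close>, \<open>a * d\<close> and at least one of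
  \<open>b * c\<close>, \<open>b * d\<close> are class sizes, which makes three distinct composite
  numbers.\<close>

lemma card_prime_class_sizes_le:
  assumes fin: "finite (carrier G)" and two: "card {c \<in> cs G. composite c} = 2"
  shows "card {c \<in> cs G. Factorial_Ring.prime c} \<le> 3"
proof (rule ccontr)
  assume "\<not> ?thesis"
  then have "4 \<le> card {c \<in> cs G. Factorial_Ring.prime c}" by simp
  then obtain T where T: "T \<subseteq> {c \<in> cs G. Factorial_Ring.prime c}" "card T = 4"
    by (meson obtain_subset_with_card_n)
  then obtain a b c d where abcd: "T = {a, b, c, d}" "a \<noteq> b" "a \<noteq> c" "a \<noteq> d" "b \<noteq> c" "b \<noteq> d" "c \<noteq> d"
    by (auto simp: card_Suc_eq eval_nat_numeral)
  let ?S = "{c \<in> cs G. composite c}"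
  have pr: "Factorial_Ring.prime a" "Factorial_Ring.prime b" "Factorial_Ring.prime c" "Factorial_Ring.prime d"
    and mem: "a \<in> cs G" "b \<in> cs G" "c \<in> cs G" "d \<in> cs G" using T abcd by auto
  have three: False if "u \<in> ?S" "v \<in> ?S" "w \<in> ?S" "u \<noteq> v" "u \<noteq> w" "v \<noteq> w" for u v w
  proof -
    have "finite ?S" using two by (metis card.infinite zero_neq_numeral)
    then have "card {u, v, w} \<le> card ?S" using that by (intro card_mono) auto
    then show False using that two by simp
  qed
  note uniq = incompatible_class_size_unique[OF fin]
  have E: "a * b \<in> ?S \<or> a * c \<in> ?S" "a * b \<in> ?S \<or> a * d \<in> ?S" "a * c \<in> ?S \<or> a * d \<in> ?S"
    "b * c \<in> ?S \<or> b * d \<in> ?S"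
    using uniq[of a b c] uniq[of a b d] uniq[of a c d] uniq[of b c d] pr mem abcd
      composite_prime_mult by auto
  have D: "a * b \<noteq> a * c" "a * b \<noteq> a * d" "a * c \<noteq> a * d" "a * b \<noteq> b * c" "a * b \<noteq> b * d"
    "a * c \<noteq> b * c" "a * c \<noteq> b * d" "a * d \<noteq> b * c" "a * d \<noteq> b * d"
    using abcd by (simp_all add: prime_mult_eq_iff pr doubleton_eq_iff prime_gt_0_nat del: mult_cancel1 mult_cancel2)
  show False
    using E D three[of "a * b" "a * c" "b * c"] three[of "a * b" "a * c" "b * d"]
      three[of "a * b" "a * d" "b * c"] three[of "a * b" "a * d" "b * d"]
      three[of "a * c" "a * d" "b * c"] three[of "a * c" "a * d" "b * d"]
    by argo
qed

text \<open>At most one of the three products of two of the primes is missing from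
  \<open>cs G\<close>, so two of them occur and have to be \<open>m\<close> and \<open>n\<close>.
  Any two of these products share a prime, which becomes \<open>q1\<close>.\<close>

lemma three_prime_class_sizes:
  assumes fin: "finite (carrier G)" and two: "card {c \<in> cs G. composite c} = 2"
    and primes: "Factorial_Ring.prime p1" "Factorial_Ring.prime p2" "Factorial_Ring.prime p3"
    and ne: "p1 \<noteq> p2" "p1 \<noteq> p3" "p2 \<noteq> p3"
    and mn: "composite m" "composite n" "m \<noteq> n"
    and cs: "cs G = {1, p1, p2, p3, m, n}"
  shows "\<exists>q1 q2 q3. {q1, q2, q3} = {p1, p2, p3} \<and> m = q1 * q2 \<and> n = q1 * q3"
proof -
  let ?S = "{c \<in> cs G. composite c}"
  have "{m, n} \<subseteq> ?S" using cs mn by auto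
  moreover have "finite ?S" using two by (metis card.infinite zero_neq_numeral)
  ultimately have S: "?S = {m, n}" using card_subset_eq[of ?S "{m, n}"] two mn(3) by simp
  have mem: "p1 \<in> cs G" "p2 \<in> cs G" "p3 \<in> cs G" using cs by auto
  note uniq = incompatible_class_size_unique[OF fin]
  have "p1 * p2 \<in> ?S \<or> p1 * p3 \<in> ?S" "p1 * p2 \<in> ?S \<or> p2 * p3 \<in> ?S" "p1 * p3 \<in> ?S \<or> p2 * p3 \<in> ?S"
    using uniq[of p1 p2 p3] uniq[of p2 p1 p3] uniq[of p3 p1 p2] primes mem ne composite_prime_mult
    by (auto simp: mult.commute)
  then have E: "p1 * p2 \<in> {m, n} \<or> p1 * p3 \<in> {m, n}" "p1 * p2 \<in> {m, n} \<or> p2 * p3 \<in> {m, n}"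
    "p1 * p3 \<in> {m, n} \<or> p2 * p3 \<in> {m, n}" unfolding S by blast+
  have D: "p1 * p2 \<noteq> p1 * p3" "p1 * p2 \<noteq> p2 * p3" "p1 * p3 \<noteq> p2 * p3"
    using ne primes by (simp_all add: prime_mult_eq_iff doubleton_eq_iff)
  have "p1 * p2 \<in> {m, n} \<and> p1 * p3 \<in> {m, n} \<or> p2 * p1 \<in> {m, n} \<and> p2 * p3 \<in> {m, n}
    \<or> p3 * p1 \<in> {m, n} \<and> p3 * p2 \<in> {m, n}"
    using E by (simp only: mult.commute[of p2 p1] mult.commute[of p3 p1] mult.commute[of p3 p2]) blast
  moreover have ?thesis if "u * v \<in> {m, n}" "u * w \<in> {m, n}" "u * v \<noteq> u * w" "{u, v, w} = {p1, p2, p3}"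
    for u v w
  proof -
    have "m = u * v \<and> n = u * w \<or> m = u * w \<and> n = u * v" using that(1-3) by auto
    moreover have "{u, w, v} = {p1, p2, p3}" using that(4) by (simp add: insert_commute)
    ultimately show ?thesis using that(4) by blast
  qed
  note this[of p1 p2 p3] this[of p2 p1 p3] this[of p3 p1 p2]
  ultimately show ?thesis using D by (auto simp: mult.commute insert_commute)
qed

end

theorem theoremA:
  fixes G :: "('a, 'b) monoid_scheme"
  assumes "group G" and "finite (carrier G)"
    and "card {c \<in> cs G. composite c} = 2"
  shows "card {c \<in> cs G. Factorial_Ring.prime c} \<le> 3 \<and>
    (\<forall>p1 p2 p3 m n :: nat.
       Factorial_Ring.prime p1 \<and> Factorial_Ring.prime p2 \<and> Factorial_Ring.prime p3 \<and>
       p1 \<noteq> p2 \<and> p1 \<noteq> p3 \<and> p2 \<noteq> p3 \<and>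
       composite m \<and> composite n \<and> m \<noteq> n \<and>
       cs G = {1, p1, p2, p3, m, n} \<longrightarrow>
       (\<exists>q1 q2 q3. {q1, q2, q3} = {p1, p2, p3} \<and>
          m = q1 * q2 \<and> n = q1 * q3 \<and>
          up_to_abelian_direct_factors
            (\<lambda>G0. \<exists>P H. internal_direct_product G0 P H \<and>
               p_group q1 (G0\<lparr>carrier := P\<rparr>) \<and>
               nilpotent_group (G0\<lparr>carrier := P\<rparr>) \<and>
               nilpotency_class (G0\<lparr>carrier := P\<rparr>) \<le> 2 \<and>
               cs (G0\<lparr>carrier := P\<rparr>) = {1, q1} \<and>
               frobenius_group (G0\<lparr>carrier := H\<rparr> Mod center (G0\<lparr>carrier := H\<rparr>)) \<and>
               order (G0\<lparr>carrier := H\<rparr> Mod center (G0\<lparr>carrier := H\<rparr>)) = q2 * q3 \<and>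
               cs (G0\<lparr>carrier := H\<rparr>) = {1, q2, q3})
            G))"
proof -
  interpret group G by fact
  have "\<exists>q1 q2 q3. {q1, q2, q3} = {p1, p2, p3} \<and> m = q1 * q2 \<and> n = q1 * q3 \<and>
      up_to_abelian_direct_factors
        (\<lambda>G0. \<exists>P H. internal_direct_product G0 P H \<and>
           p_group q1 (G0\<lparr>carrier := P\<rparr>) \<and>
           nilpotent_group (G0\<lparr>carrier := P\<rparr>) \<and>
           nilpotency_class (G0\<lparr>carrier := P\<rparr>) \<le> 2 \<and>
           cs (G0\<lparr>carrier := P\<rparr>) = {1, q1} \<and>
           frobenius_group (G0\<lparr>carrier := H\<rparr> Mod center (G0\<lparr>carrier := H\<rparr>)) \<and>
           order (G0\<lparr>carrier := H\<rparr> Mod center (G0\<lparr>carrier := H\<rparr>)) = q2 * q3 \<and>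
           cs (G0\<lparr>carrier := H\<rparr>) = {1, q2, q3}) G"
    if h: "Factorial_Ring.prime p1 \<and> Factorial_Ring.prime p2 \<and> Factorial_Ring.prime p3 \<and>
       p1 \<noteq> p2 \<and> p1 \<noteq> p3 \<and> p2 \<noteq> p3 \<and>
       composite m \<and> composite n \<and> m \<noteq> n \<and> cs G = {1, p1, p2, p3, m, n}" for p1 p2 p3 m n :: nat
  proof -
    obtain q1 q2 q3 where q: "{q1, q2, q3} = {p1, p2, p3}" "m = q1 * q2" "n = q1 * q3"
      using three_prime_class_sizes[OF assms(2,3), of p1 p2 p3 m n] h by blast
    \<comment> \<open>The relabelling is known only as an equality of sets; the cardinality
      transfers distinctness to the new labels.\<close>
    have "card {q1, q2, q3} = 3" unfolding q(1) using h by simp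
    then have ne: "q1 \<noteq> q2" "q1 \<noteq> q3" "q2 \<noteq> q3" by (auto simp: card_insert_if split: if_splits)
    have "\<forall>x\<in>{q1, q2, q3}. Factorial_Ring.prime x" unfolding q(1) using h by simp
    then have pr: "Factorial_Ring.prime q1" "Factorial_Ring.prime q2" "Factorial_Ring.prime q3" by auto
    have "cs G = {1, m, n} \<union> {p1, p2, p3}" using h by auto
    then have "cs G = {1, q1, q2, q3, q1 * q2, q1 * q3}" unfolding q(1)[symmetric] q(2,3) by auto
    then have "\<exists>P H. internal_direct_product G P H \<and> p_group q1 (G\<lparr>carrier := P\<rparr>) \<and>
        nilpotent_group (G\<lparr>carrier := P\<rparr>) \<and> nilpotency_class (G\<lparr>carrier := P\<rparr>) \<le> 2 \<and>
        cs (G\<lparr>carrier := P\<rparr>) = {1, q1} \<and>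
        frobenius_group (G\<lparr>carrier := H\<rparr> Mod center (G\<lparr>carrier := H\<rparr>)) \<and>
        order (G\<lparr>carrier := H\<rparr> Mod center (G\<lparr>carrier := H\<rparr>)) = q2 * q3 \<and>
        cs (G\<lparr>carrier := H\<rparr>) = {1, q2, q3}"
      by (rule class_sizes_structure[OF assms(2) pr ne])
    then show ?thesis
      by (intro exI[of _ q1] exI[of _ q2] exI[of _ q3] conjI q up_to_abelian_direct_factorsI)
  qed
  then show ?thesis using card_prime_class_sizes_le[OF assms(2,3)] by blast
qed

end
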